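(* A Banach lattice $E$ is reflexive if and only if $E$ has the unbounded Grothendieck property.
   Context: For a Banach lattice $E$ with dual $E'$, a sequence $(x_n')\subseteq E'$ is unbounded weak$^*$ convergent to $0$ (written $x_n'\xrightarrow{uaw^*}0$) if $|x_n'|\wedge u'\to 0$ in the weak$^*$ topology $\sigma(E',E)$ for every $u'\in E'_+$. $E$ has the unbounded Grothendieck property if every norm bounded sequence $(x_n')\subseteq E'$ with $x_n'\xrightarrow{uaw^*}0$ converges to $0$ weakly (in $\sigma(E',E'')$). *)

theory Defs
  imports "HOL-Analysis.Analysis"
begin

definition lat_abs :: "'a::{lattice, uminus} \<Rightarrow> 'a" where
  "lat_abs x = sup x (- x)"

class banach_lattice = banach + ordered_real_vector + lattice +
  assumes lattice_norm: "sup x (- x) \<le> sup y (- y) \<Longrightarrow> norm x \<le> norm y"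

definition pos_part :: "'a::banach_lattice \<Rightarrow> 'a" where
  "pos_part x = sup x 0"

definition neg_part :: "'a::banach_lattice \<Rightarrow> 'a" where
  "neg_part x = sup (- x) 0"

definition dual_pos :: "('a::banach_lattice \<Rightarrow>\<^sub>L real) \<Rightarrow> bool" where
  "dual_pos u \<longleftrightarrow> (\<forall>x. 0 \<le> x \<longrightarrow> 0 \<le> blinfun_apply u x)"

text \<open>Lattice operations on E' via the Riesz--Kantorovich formulas.
 |f|(x) = sup { |f y| : |y| \<le> x }  for x \<ge> 0;
 (g \<wedge> h)(x) = inf { g y + h (x - y) : 0 \<le> y \<le> x }  for x \<ge> 0;
 a functional given on the positive cone is extended by p(x) = p(x+) - p(x-) with x+ = x \<or> 0, x- = (-x) \<or> 0.\<close>
definition dual_abs_pos :: "('a::banach_lattice \<Rightarrow>\<^sub>L real) \<Rightarrow> 'a \<Rightarrow> real" where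
  "dual_abs_pos f x = (SUP y\<in>{y. lat_abs y \<le> x}. \<bar>blinfun_apply f y\<bar>)"

definition dual_inf_pos :: "('a::banach_lattice \<Rightarrow> real) \<Rightarrow> ('a \<Rightarrow> real) \<Rightarrow> 'a \<Rightarrow> real" where
  "dual_inf_pos g h x = (INF y\<in>{y. 0 \<le> y \<and> y \<le> x}. g y + h (x - y))"

definition dual_ext :: "('a::banach_lattice \<Rightarrow> real) \<Rightarrow> 'a \<Rightarrow> real" where
  "dual_ext p x = p (pos_part x) - p (neg_part x)"

definition dual_abs_inf :: "('a::banach_lattice \<Rightarrow>\<^sub>L real) \<Rightarrow> ('a \<Rightarrow>\<^sub>L real) \<Rightarrow> 'a \<Rightarrow> real" where
  "dual_abs_inf f u = dual_ext (dual_inf_pos (dual_abs_pos f) (blinfun_apply u))"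

definition uaw_star_null :: "(nat \<Rightarrow> ('a::banach_lattice \<Rightarrow>\<^sub>L real)) \<Rightarrow> bool" where
  "uaw_star_null xs \<longleftrightarrow>
     (\<forall>u. dual_pos u \<longrightarrow> (\<forall>x. (\<lambda>n. dual_abs_inf (xs n) u x) \<longlonglongrightarrow> 0))"

definition weakly_null_dual :: "(nat \<Rightarrow> ('a::banach_lattice \<Rightarrow>\<^sub>L real)) \<Rightarrow> bool" where
  "weakly_null_dual xs \<longleftrightarrow>
     (\<forall>\<phi> :: ('a \<Rightarrow>\<^sub>L real) \<Rightarrow>\<^sub>L real. (\<lambda>n. blinfun_apply \<phi> (xs n)) \<longlonglongrightarrow> 0)"

definition unbounded_grothendieck :: "'a::banach_lattice itself \<Rightarrow> bool" where
  "unbounded_grothendieck _ \<longleftrightarrow>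
     (\<forall>xs :: nat \<Rightarrow> ('a \<Rightarrow>\<^sub>L real).
        bounded (range xs) \<longrightarrow> uaw_star_null xs \<longrightarrow> weakly_null_dual xs)"

definition canonical_embedding :: "'a::real_normed_vector \<Rightarrow> (('a \<Rightarrow>\<^sub>L real) \<Rightarrow>\<^sub>L real)" where
  "canonical_embedding x = Blinfun (\<lambda>f. blinfun_apply f x)"

definition reflexive_space :: "'a::real_normed_vector itself \<Rightarrow> bool" where
  "reflexive_space _ \<longleftrightarrow> surj (canonical_embedding :: 'a \<Rightarrow> _)"

end

theory Submission
  imports Defs "HOL-Library.Lattice_Algebras"
begin

text \<open>
  If \<open>E\<close> is reflexive, monotone norm bounded sequences in \<open>E\<close> converge in norm (\<open>E\<close> is a KB-space).  Let
  \<open>h n = |x n'|\<close> and suppose \<open>h n (x) \<ge> \<delta>\<close> along a subsequence.  Since \<open>h n \<and> u\<close> tends to \<open>0\<close> at \<open>x\<close>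
  for every \<open>u\<close>, after thinning out there are \<open>z n\<close> between \<open>0\<close> and \<open>x\<close> with \<open>h n (z n)\<close> large and
  \<open>h i (z n)\<close> summably small for \<open>i < n\<close>; evaluating at the decreasing, hence norm convergent, suprema
  of the tails of \<open>z\<close> gives a contradiction.

  Conversely, the unbounded Grothendieck property makes \<open>E'\<close> a KB-space, because functionals decreasing
  pointwise to \<open>0\<close> are unbounded weak* null.  It also makes \<open>E\<close> a KB-space: norming functionals of
  the increments of a divergent bounded increasing sequence can be made almost disjoint, and then they are
  unbounded weak* null although the weak* limit of the sequence in \<open>E''\<close> stays away from \<open>0\<close> on them.
  Finally, if \<open>E\<close> and \<open>E'\<close> are KB-spaces and \<open>\<phi> \<ge> 0\<close> in \<open>E''\<close>, let \<open>s\<close> be the largest element of \<open>E\<close> below \<open>\<phi>\<close>.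
  Nakano's carrier argument shows that \<open>\<phi> - s\<close> is disjoint from \<open>E\<close>, and then that it vanishes.
\<close>

section \<open>Banach lattices\<close>

instance banach_lattice \<subseteq> lattice_ab_group_add ..

lemma sup_eq_pprt: "sup a b = b + pprt (a - b)" for a b :: "'a::lattice_ab_group_add"
  by (simp add: pprt_def add_sup_distrib_left)

lemma inf_eq_pprt: "inf a b = a - pprt (a - b)" for a b :: "'a::lattice_ab_group_add"
  by (simp add: pprt_def diff_sup_eq_inf add_inf_distrib_left inf_commute)

lemma le_pprt: "a \<le> pprt a" for a :: "'a::lattice_ab_group_add"
  by (simp add: pprt_def)

lemma pprt_least: "a \<le> b \<Longrightarrow> 0 \<le> b \<Longrightarrow> pprt a \<le> b" for a :: "'a::lattice_ab_group_add"
  by (simp add: pprt_def)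

lemma pprt_diff_pprt: "pprt a - pprt (- a) = a" for a :: "'a::lattice_ab_group_add"
  using prts[of a] by (simp add: pprt_neg)

text \<open>By \<open>inf_eq_pprt\<close>, the infimum of the positive and the negative part of
  \<open>a\<close>, whose difference is \<open>a\<close>, equals
  \<open>pprt a - pprt a\<close>.\<close>

lemma inf_pprt_pprt_uminus: "inf (pprt a) (pprt (- a)) = 0" for a :: "'a::lattice_ab_group_add"
proof -
  have "pprt (pprt a - pprt (- a)) = pprt a" by (simp only: pprt_diff_pprt)
  then show ?thesis by (simp only: inf_eq_pprt[of "pprt a"]) simp
qed

lemma pprt_add_le: "pprt (a + b) \<le> pprt a + pprt b" for a :: "'a::lattice_ab_group_add"
  by (intro pprt_least add_mono le_pprt add_nonneg_nonneg zero_le_pprt)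

lemma lat_abs_eq: "lat_abs a = pprt a + pprt (- a)" for a :: "'a::lattice_ab_group_add"
proof -
  have "inf (pprt a) (pprt (- a)) = 0" by (rule inf_pprt_pprt_uminus)
  then have "pprt a + pprt (- a) = sup (pprt a) (pprt (- a))"
    using add_eq_inf_sup[of "pprt a" "pprt (- a)"] by simp
  also have "\<dots> = sup (lat_abs a) 0"
    by (simp add: pprt_def lat_abs_def sup_left_commute sup_commute sup_assoc)
  also have "\<dots> = lat_abs a"
  proof -
    have "0 \<le> lat_abs a + lat_abs a"
      using add_mono[of a "lat_abs a" "- a" "lat_abs a"] by (simp add: lat_abs_def)
    then have "0 \<le> lat_abs a" by simp
    then show ?thesis by (simp add: sup_absorb1)
  qed
  finally show ?thesis by simp
qed

lemma lat_abs_nonneg: "0 \<le> lat_abs a" for a :: "'a::lattice_ab_group_add"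
  by (simp add: lat_abs_eq)

lemma lat_abs_of_nonneg: "0 \<le> a \<Longrightarrow> lat_abs a = a" for a :: "'a::lattice_ab_group_add"
  by (simp add: lat_abs_eq pprt_eq_0)

lemma lat_abs_minus: "lat_abs (- a) = lat_abs a" for a :: "'a::lattice_ab_group_add"
  by (simp add: lat_abs_def sup_commute)

lemma le_lat_abs: "a \<le> lat_abs a" "- a \<le> lat_abs a" for a :: "'a::lattice_ab_group_add"
  by (simp_all add: lat_abs_def)

lemma lat_abs_le_iff: "lat_abs a \<le> b \<longleftrightarrow> a \<le> b \<and> - a \<le> b" for a :: "'a::lattice_ab_group_add"
  by (simp add: lat_abs_def)

lemma norm_le_if_lat_abs_le: "lat_abs x \<le> y \<Longrightarrow> norm x \<le> norm y" for x y :: "'a::banach_lattice"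
  using lattice_norm[of x y] by (simp add: lat_abs_def) (meson le_supI1 order_trans)

lemma norm_mono: "0 \<le> x \<Longrightarrow> x \<le> y \<Longrightarrow> norm x \<le> norm y" for x y :: "'a::banach_lattice"
  by (rule norm_le_if_lat_abs_le) (simp add: lat_abs_of_nonneg)

lemma norm_lat_abs: "norm (lat_abs x) = norm x" for x :: "'a::banach_lattice"
proof (rule antisym)
  show "norm (lat_abs x) \<le> norm x"
    by (rule lattice_norm) (use lat_abs_of_nonneg[OF lat_abs_nonneg, of x] in \<open>simp add: lat_abs_def\<close>)
qed (simp add: norm_le_if_lat_abs_le)

lemma norm_pprt_le: "norm (pprt x) \<le> norm x" for x :: "'a::banach_lattice"
  using norm_mono[of "pprt x" "lat_abs x"] by (simp add: norm_lat_abs) (simp add: lat_abs_eq)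

text \<open>The pointwise estimate a+ <= b+ + |a - b| makes the positive part 1-Lipschitz.
  Continuity of \<open>sup\<close> and \<open>inf\<close> follows, since both are expressed through
  \<open>pprt\<close>.\<close>

lemma norm_pprt_diff_le: "norm (pprt x - pprt y) \<le> norm (x - y)" for x y :: "'a::banach_lattice"
proof -
  have "pprt a - pprt b \<le> lat_abs (a - b)" for a b :: 'a
  proof -
    have "pprt a \<le> pprt b + pprt (a - b)" using pprt_add_le[of b "a - b"] by simp
    also have "\<dots> \<le> pprt b + lat_abs (a - b)" by (simp add: lat_abs_eq)
    finally show ?thesis by (simp add: algebra_simps)
  qed
  from this[of x y] this[of y x] have "lat_abs (pprt x - pprt y) \<le> lat_abs (x - y)"
    using lat_abs_minus[of "x - y"] by (simp add: lat_abs_le_iff)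
  then show ?thesis using norm_le_if_lat_abs_le norm_lat_abs by metis
qed

lemma tendsto_pprt:
  fixes f :: "'b \<Rightarrow> 'a::banach_lattice"
  assumes "(f \<longlongrightarrow> l) F"
  shows "((\<lambda>x. pprt (f x)) \<longlongrightarrow> pprt l) F"
proof -
  have "((\<lambda>x. norm (f x - l)) \<longlongrightarrow> 0) F"
    using assms by (simp add: LIM_zero tendsto_norm_zero)
  then have "((\<lambda>x. norm (pprt (f x) - pprt l)) \<longlongrightarrow> 0) F"
    by (rule Lim_null_comparison[rotated]) (simp add: norm_pprt_diff_le)
  then show ?thesis by (simp add: tendsto_norm_zero_iff LIM_zero_iff)
qed

lemma tendsto_sup:
  fixes f g :: "'b \<Rightarrow> 'a::banach_lattice"
  assumes "(f \<longlongrightarrow> a) F" "(g \<longlongrightarrow> b) F"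
  shows "((\<lambda>x. sup (f x) (g x)) \<longlongrightarrow> sup a b) F"
  unfolding sup_eq_pprt by (intro tendsto_intros tendsto_pprt assms)

lemma tendsto_inf:
  fixes f g :: "'b \<Rightarrow> 'a::banach_lattice"
  assumes "(f \<longlongrightarrow> a) F" "(g \<longlongrightarrow> b) F"
  shows "((\<lambda>x. inf (f x) (g x)) \<longlongrightarrow> inf a b) F"
  unfolding inf_eq_pprt by (intro tendsto_intros tendsto_pprt assms)

text \<open>Closedness of the positive cone: the identity \<open>sup (f n) (g n) = g n\<close>
  survives in the limit because \<open>sup\<close> is continuous.\<close>

lemma lattice_tendsto_le:
  fixes f g :: "nat \<Rightarrow> 'a::banach_lattice"
  assumes f: "f \<longlonglongrightarrow> a" and g: "g \<longlonglongrightarrow> b" and le: "\<And>n. N \<le> n \<Longrightarrow> f n \<le> g n"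
  shows "a \<le> b"
proof -
  have "(\<lambda>n. sup (f n) (g n)) \<longlonglongrightarrow> sup a b" by (rule tendsto_sup[OF f g])
  moreover have "\<forall>\<^sub>F n in sequentially. sup (f n) (g n) = g n"
    using le by (intro eventually_sequentiallyI[of N]) (simp add: sup_absorb2)
  ultimately have "g \<longlonglongrightarrow> sup a b" by (simp cong: tendsto_cong)
  then have "sup a b = b" using g LIMSEQ_unique by blast
  then show ?thesis by (metis sup_ge1)
qed

lemma pprt_scaleR:
  fixes x :: "'a::banach_lattice"
  assumes "0 \<le> t" shows "pprt (t *\<^sub>R x) = t *\<^sub>R pprt x"
proof (cases "t = 0")
  case False
  with assms have t: "0 < t" by simp
  have le: "pprt (s *\<^sub>R y) \<le> s *\<^sub>R pprt y" if "0 < s" for s and y :: 'a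
    using that by (intro pprt_least scaleR_left_mono le_pprt scaleR_nonneg_nonneg) auto
  \<comment> \<open>The reverse inequality is the same estimate for the scalar 1/t and the vector t
    x.\<close>
  have "pprt x \<le> (1 / t) *\<^sub>R pprt (t *\<^sub>R x)" using le[of "1 / t" "t *\<^sub>R x"] t by simp
  then have "t *\<^sub>R pprt x \<le> t *\<^sub>R (1 / t) *\<^sub>R pprt (t *\<^sub>R x)"
    using t by (intro scaleR_left_mono) auto
  then show ?thesis using le[OF t, of x] t by simp
qed simp

lemma inf_scaleR:
  fixes x y :: "'a::banach_lattice"
  assumes "0 \<le> t" shows "inf (t *\<^sub>R x) (t *\<^sub>R y) = t *\<^sub>R inf x y"
  using assms by (simp add: inf_eq_pprt scaleR_diff_right pprt_scaleR flip: scaleR_diff_right)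

text \<open>Removing a large multiple of \<open>b\<close> from \<open>a\<close> leaves an element
  almost disjoint from \<open>b\<close>. The infimum \<open>w\<close> lies below the positive part
  \<open>p\<close> of a - t w. The negative part \<open>v\<close> of that element lies below t w,
  hence below t p, yet it is disjoint from \<open>p\<close>. So \<open>v\<close> vanishes, that is,
  t w <= a.\<close>

lemma inf_pprt_diff_scaleR_le:
  fixes a b :: "'a::banach_lattice"
  assumes a: "0 \<le> a" and b: "0 \<le> b" and t: "1 \<le> t"
  shows "inf (pprt (a - t *\<^sub>R b)) b \<le> (1 / t) *\<^sub>R a"
proof -
  define w where "w = inf (pprt (a - t *\<^sub>R b)) b"
  have w0: "0 \<le> w" using b by (simp add: w_def)
  have tw: "t *\<^sub>R w \<le> t *\<^sub>R b" using t by (intro scaleR_left_mono) (auto simp: w_def)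
  define p where "p = pprt (a - t *\<^sub>R w)"
  define v where "v = pprt (- (a - t *\<^sub>R w))"
  have wp: "w \<le> p"
  proof -
    have "w \<le> pprt (a - t *\<^sub>R b)" by (simp add: w_def)
    also have "\<dots> \<le> p" unfolding p_def using tw by (intro pprt_mono diff_left_mono)
    finally show ?thesis .
  qed
  have "v \<le> t *\<^sub>R w" unfolding v_def using a w0 t by (intro pprt_least) (auto intro: scaleR_nonneg_nonneg)
  also have "\<dots> \<le> t *\<^sub>R p" using wp t by (intro scaleR_left_mono) auto
  finally have "v \<le> t *\<^sub>R p" .
  moreover have "v \<le> t *\<^sub>R v" using scaleR_right_mono[OF t, of v] by (simp add: v_def)
  ultimately have "v \<le> inf (t *\<^sub>R p) (t *\<^sub>R v)" by simp
  also have "\<dots> = 0" using t inf_pprt_pprt_uminus[of "a - t *\<^sub>R w"] by (simp add: inf_scaleR p_def v_def)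
  finally have "- (a - t *\<^sub>R w) \<le> 0" unfolding v_def by (rule order_trans[OF le_pprt])
  then have "t *\<^sub>R w \<le> a" by simp
  then have "(1 / t) *\<^sub>R (t *\<^sub>R w) \<le> (1 / t) *\<^sub>R a" using t by (intro scaleR_left_mono) auto
  then show ?thesis using t by (simp add: w_def)
qed

text \<open>The first part is \<open>inf z x\<close>. What remains is the positive part of z - x,
  which lies below y because both z - x and 0 do.\<close>

lemma riesz_decomposition:
  fixes x y z :: "'a::lattice_ab_group_add"
  assumes "0 \<le> z" "z \<le> x + y" "0 \<le> x" "0 \<le> y"
  obtains z1 z2 where "z = z1 + z2" "0 \<le> z1" "z1 \<le> x" "0 \<le> z2" "z2 \<le> y"
proof
  have eq: "z - inf z x = pprt (z - x)" by (simp add: inf_eq_pprt)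
  show "z = inf z x + (z - inf z x)" by (metis add_diff_cancel_left' diff_add_cancel add.commute)
  show "inf z x \<le> x" "0 \<le> inf z x" using assms by simp_all
  show "0 \<le> z - inf z x" unfolding eq by simp
  show "z - inf z x \<le> y" unfolding eq using assms by (intro pprt_least) (simp_all add: algebra_simps)
qed

section \<open>The Hahn--Banach theorem\<close>

definition sublinear :: "('a::real_vector \<Rightarrow> real) \<Rightarrow> bool" where
  "sublinear p \<longleftrightarrow> (\<forall>x y. p (x + y) \<le> p x + p y) \<and> (\<forall>t\<ge>0. \<forall>x. p (t *\<^sub>R x) \<le> t * p x)"

lemma sublinear_add: "sublinear p \<Longrightarrow> p (x + y) \<le> p x + p y"
  by (simp add: sublinear_def)

lemma sublinear_scaleR: "sublinear p \<Longrightarrow> 0 \<le> t \<Longrightarrow> p (t *\<^sub>R x) \<le> t * p x"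
  by (simp add: sublinear_def)

lemma sublinear_zero: "sublinear p \<Longrightarrow> p 0 = 0"
  using sublinear_add[of p 0 0] sublinear_scaleR[of p 0 0] by simp

lemma sublinear_uminus: "sublinear p \<Longrightarrow> - p (- x) \<le> p x"
  using sublinear_add[of p x "- x"] sublinear_zero[of p] by simp

lemma sublinear_scaleR_eq:
  assumes p: "sublinear p" and t: "0 \<le> t" shows "p (t *\<^sub>R x) = t * p x"
proof (cases "t = 0")
  case True
  then show ?thesis using sublinear_zero[OF p] by simp
next
  case False
  then show ?thesis
    using t sublinear_scaleR[OF p t, of x] sublinear_scaleR[OF p, of "1 / t" "t *\<^sub>R x"]
    by (simp add: field_simps)
qed

text \<open>A pair (a, c) encodes the constraint c <= f a on a linear functional f that is sought.
  Such constraints can be added and multiplied by positive numbers, hence the convex cone.\<close>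

definition cone_pairs :: "('a::real_vector \<times> real) set \<Rightarrow> bool" where
  "cone_pairs A \<longleftrightarrow> 0 \<in> A \<and> (\<forall>z\<in>A. \<forall>w\<in>A. z + w \<in> A) \<and> (\<forall>t>0. \<forall>z\<in>A. t *\<^sub>R z \<in> A)"

text \<open>Lowering p by the constraints keeps it sublinear, and a linear f below q then satisfies
  f (- a) <= - c, which is the constraint c <= f a.\<close>

lemma sublinear_cone_INF:
  fixes A :: "('a::real_vector \<times> real) set"
  assumes p: "sublinear p" and A: "cone_pairs A" and le: "\<forall>(a, c)\<in>A. c \<le> p a"
  defines "q \<equiv> \<lambda>v. INF z\<in>A. p (v + fst z) - snd z"
  shows "sublinear q" and "q v \<le> p v" and "(a, c) \<in> A \<Longrightarrow> q (- a) \<le> - c"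
proof -
  have A0: "0 \<in> A" using A by (simp add: cone_pairs_def)
  \<comment> \<open>The infimum is finite since c <= p a <= p (v + a) + p (- v).\<close>
  have bdd: "bdd_below ((\<lambda>z. p (v + fst z) - snd z) ` A)" for v
  proof (rule bdd_belowI2)
    fix z assume "z \<in> A"
    then have "snd z \<le> p (fst z)" using le by force
    then show "- p (- v) \<le> p (v + fst z) - snd z"
      using sublinear_add[OF p, of "v + fst z" "- v"] by simp
  qed
  have upper: "q v \<le> p (v + fst z) - snd z" if "z \<in> A" for v z
    unfolding q_def using that bdd by (rule cINF_lower[rotated])
  have greatest: "b \<le> q v" if "\<And>z. z \<in> A \<Longrightarrow> b \<le> p (v + fst z) - snd z" for b v
    unfolding q_def using A0 that by (intro cINF_greatest) auto
  show "q v \<le> p v" using upper[OF A0] by simp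
  show "q (- a) \<le> - c" if "(a, c) \<in> A" using upper[OF that, of "- a"] sublinear_zero[OF p] by simp
  show "sublinear q"
    unfolding sublinear_def
  proof (intro conjI allI impI)
    fix x y
    \<comment> \<open>The infima for \<open>q x\<close> and \<open>q y\<close> are taken one after
      the other: over z with w fixed, and then over w.\<close>
    have "q (x + y) - (p (y + fst w) - snd w) \<le> q x" if w: "w \<in> A" for w
    proof (rule greatest)
      fix z assume "z \<in> A"
      then have "z + w \<in> A" using A w by (simp add: cone_pairs_def)
      from upper[OF this, of "x + y"] sublinear_add[OF p, of "x + fst z" "y + fst w"]
      show "q (x + y) - (p (y + fst w) - snd w) \<le> p (x + fst z) - snd z"
        by (simp add: algebra_simps)
    qed
    then have "q (x + y) - q x \<le> q y" by (intro greatest) (simp add: algebra_simps)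
    then show "q (x + y) \<le> q x + q y" by simp
  next
    fix t :: real and x :: 'a assume t: "0 \<le> t"
    show "q (t *\<^sub>R x) \<le> t * q x"
    proof (cases "t = 0")
      case True
      then show ?thesis using upper[OF A0, of 0] sublinear_zero[OF p] by simp
    next
      case False
      with t have t: "0 < t" by simp
      have "q (t *\<^sub>R x) / t \<le> q x"
      proof (rule greatest)
        fix z assume "z \<in> A"
        then have "t *\<^sub>R z \<in> A" using A t by (simp add: cone_pairs_def)
        from upper[OF this, of "t *\<^sub>R x"] sublinear_scaleR[OF p, of t "x + fst z"] t
        have "q (t *\<^sub>R x) \<le> (p (x + fst z) - snd z) * t" by (simp add: algebra_simps)
        then show "q (t *\<^sub>R x) / t \<le> p (x + fst z) - snd z" using t by (simp add: divide_le_eq)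
      qed
      then show ?thesis using t by (simp add: divide_le_eq mult.commute)
    qed
  qed
qed

lemma cone_pairs_ray: "cone_pairs {(t *\<^sub>R a, t * c) | t. 0 \<le> t}"
  unfolding cone_pairs_def
proof (intro conjI ballI allI impI)
  show "0 \<in> {(t *\<^sub>R a, t * c) |t. 0 \<le> t}" by (auto intro!: exI[of _ 0] simp: zero_prod_def)
next
  fix z w assume "z \<in> {(t *\<^sub>R a, t * c) |t. 0 \<le> t}" "w \<in> {(t *\<^sub>R a, t * c) |t. 0 \<le> t}"
  then obtain s t where "z = (s *\<^sub>R a, s * c)" "w = (t *\<^sub>R a, t * c)" "0 \<le> s" "0 \<le> t" by auto
  then show "z + w \<in> {(t *\<^sub>R a, t * c) |t. 0 \<le> t}"
    by (auto intro!: exI[of _ "s + t"] simp: algebra_simps)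
next
  fix s :: real and z assume s: "0 < s" and "z \<in> {(t *\<^sub>R a, t * c) |t. 0 \<le> t}"
  then obtain t where "z = (t *\<^sub>R a, t * c)" "0 \<le> t" by auto
  then show "s *\<^sub>R z \<in> {(t *\<^sub>R a, t * c) |t. 0 \<le> t}"
    using s by (auto intro!: exI[of _ "s * t"])
qed

text \<open>A minimal sublinear functional is linear, because lowering it along a ray changes nothing.\<close>

lemma linear_below_sublinear:
  fixes q :: "'a::real_vector \<Rightarrow> real"
  assumes q: "sublinear q"
  obtains f where "linear f" "\<And>x. f x \<le> q x"
proof -
  define S where "S = {p. sublinear p \<and> p \<le> q}"
  \<comment> \<open>The order is reversed, so that the maximal element from Zorn's lemma is a
    minimal sublinear functional.\<close>
  let ?P = "\<lambda>p p'. p' \<le> (p :: 'a \<Rightarrow> real)"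
  have "\<exists>m\<in>S. \<forall>p\<in>S. p \<le> m \<longrightarrow> p = m"
  proof (rule predicate_Zorn[where P = ?P])
    show "partial_order_on S (relation_of ?P S)"
      by (auto simp: partial_order_on_def preorder_on_def refl_on_def trans_def antisym_def relation_of_def)
  next
    fix C assume C: "C \<in> Chains (relation_of ?P S)"
    then have CS: "C \<subseteq> S" by (auto simp: Chains_def relation_of_def)
    have total: "p \<le> p' \<or> p' \<le> p" if "p \<in> C" "p' \<in> C" for p p'
      using C that by (auto simp: Chains_def relation_of_def)
    show "\<exists>u\<in>S. \<forall>a\<in>C. u \<le> a"
    proof (cases "C = {}")
      case True
      then show ?thesis using q by (auto simp: S_def)
    next
      case False
      \<comment> \<open>The pointwise infimum bounds the chain from below. It is subadditive because
        two members of a chain can both be replaced by the smaller one.\<close>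
      define u where "u = (\<lambda>x. INF p\<in>C. p x)"
      have bdd: "bdd_below ((\<lambda>p. p x) ` C)" for x
      proof (rule bdd_belowI2)
        fix p assume "p \<in> C"
        then have "sublinear p" "p (- x) \<le> q (- x)" using CS by (auto simp: S_def le_fun_def)
        then show "- q (- x) \<le> p x" using sublinear_uminus[of p x] by simp
      qed
      have upper: "u x \<le> p x" if "p \<in> C" for x p
        unfolding u_def using that bdd by (rule cINF_lower[rotated])
      have greatest: "b \<le> u x" if "\<And>p. p \<in> C \<Longrightarrow> b \<le> p x" for b x
        unfolding u_def using False that by (intro cINF_greatest) auto
      have "sublinear u"
        unfolding sublinear_def
      proof (intro conjI allI impI)
        fix x y
        have "u (x + y) \<le> p x + p' y" if "p \<in> C" "p' \<in> C" for p p'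
        proof -
          have "\<exists>r\<in>C. r \<le> p \<and> r \<le> p'" using total[OF that] that by auto
          then obtain r where r: "r \<in> C" "r \<le> p" "r \<le> p'" by auto
          then have "u (x + y) \<le> r x + r y"
            using upper[of r "x + y"] CS sublinear_add[of r x y] by (auto simp: S_def)
          also have "\<dots> \<le> p x + p' y" using r(2,3) by (intro add_mono) (auto simp: le_fun_def)
          finally show ?thesis .
        qed
        then have "u (x + y) - p x \<le> u y" if "p \<in> C" for p
          by (intro greatest) (metis that diff_le_eq add.commute)
        then have "u (x + y) - u y \<le> u x" by (intro greatest) (simp add: diff_le_eq add.commute)
        then show "u (x + y) \<le> u x + u y" by simp
      next
        fix t :: real and x :: 'a assume t: "0 \<le> t"
        have le: "u (t *\<^sub>R x) \<le> t * p x" if "p \<in> C" for p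
          using upper[OF that, of "t *\<^sub>R x"] sublinear_scaleR[of p t x] that CS t by (auto simp: S_def)
        show "u (t *\<^sub>R x) \<le> t * u x"
        proof (cases "t = 0")
          case True
          then show ?thesis using le False by auto
        next
          case False
          with t have "u (t *\<^sub>R x) / t \<le> u x"
            using le by (intro greatest) (auto simp: divide_le_eq mult.commute)
          then show ?thesis using t False by (simp add: divide_le_eq mult.commute)
        qed
      qed
      moreover have "u \<le> q"
      proof (rule le_funI)
        fix x
        obtain p where "p \<in> C" using False by blast
        then show "u x \<le> q x" using upper[of p x] CS by (auto simp: S_def le_fun_def intro: order_trans)
      qed
      ultimately have "u \<in> S" by (simp add: S_def)
      then show ?thesis using upper by (auto simp: le_fun_def)
    qed
  qed
  then obtain m where m: "sublinear m" "m \<le> q" and min: "\<And>p. sublinear p \<Longrightarrow> p \<le> m \<Longrightarrow> p = m"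
    unfolding S_def by (auto intro: order_trans)
  \<comment> \<open>Lowering \<open>m\<close> along the ray through \<open>y\<close> gives a
    sublinear functional below \<open>m\<close>, hence \<open>m\<close> itself. The point t = 1 of
    the ray bounds its value at \<open>x\<close> by \<open>m (x + y) - m y\<close>.\<close>
  have super: "m x + m y \<le> m (x + y)" for x y
  proof -
    define A where "A = {(t *\<^sub>R y, t * m y) | t. 0 \<le> t}"
    have A: "cone_pairs A" unfolding A_def by (rule cone_pairs_ray)
    have le: "\<forall>(a, c)\<in>A. c \<le> m a"
      by (auto simp: A_def sublinear_scaleR_eq[OF m(1)])
    let ?m = "\<lambda>v. INF z\<in>A. m (v + fst z) - snd z"
    have "?m = m"
      using sublinear_cone_INF[OF m(1) A le] by (intro min) (auto simp: le_fun_def)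
    moreover have "?m x \<le> m (x + y) - m y"
    proof -
      have bdd: "bdd_below ((\<lambda>z. m (x + fst z) - snd z) ` A)"
      proof (rule bdd_belowI2)
        fix z assume "z \<in> A"
        then have "snd z \<le> m (fst z)" using le by force
        then show "- m (- x) \<le> m (x + fst z) - snd z"
          using sublinear_add[OF m(1), of "x + fst z" "- x"] by simp
      qed
      have "(y, m y) \<in> A" by (auto simp: A_def intro!: exI[of _ 1])
      from cINF_lower[OF bdd this] show ?thesis by simp
    qed
    ultimately have "m x \<le> m (x + y) - m y" by (metis (no_types, lifting))
    then show ?thesis by simp
  qed
  have add: "m (x + y) = m x + m y" for x y
    using super[of x y] sublinear_add[OF m(1), of x y] by simp
  have neg: "m (- x) = - m x" for x
    using add[of x "- x"] sublinear_zero[OF m(1)] by simp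
  have pos: "m (t *\<^sub>R x) = t * m x" if "0 \<le> t" for t x
    using sublinear_scaleR[OF m(1) that, of x] sublinear_scaleR[OF m(1) that, of "- x"]
    by (simp add: neg)
  have "m (t *\<^sub>R x) = t * m x" for t x
    using pos[of t x] pos[of "- t" x] neg[of "t *\<^sub>R x"] by (cases "0 \<le> t") auto
  then have "linear m" by (intro linearI) (auto simp: add)
  then show ?thesis using m(2) that by (auto simp: le_fun_def)
qed

text \<open>A sandwich form of Hahn--Banach, obtained from a linear functional below the lowered
  functional of \<open>sublinear_cone_INF\<close>.\<close>

lemma linear_between_cone_and_sublinear:
  fixes A :: "('a::real_vector \<times> real) set"
  assumes p: "sublinear p" and A: "cone_pairs A" and le: "\<forall>(a, c)\<in>A. c \<le> p a"
  obtains f where "linear f" "\<And>x. f x \<le> p x" "\<And>a c. (a, c) \<in> A \<Longrightarrow> c \<le> f a"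
proof -
  note q = sublinear_cone_INF[OF p A le]
  from linear_below_sublinear[OF q(1)] obtain f
    where f: "linear f" and fq: "\<And>x. f x \<le> (INF z\<in>A. p (x + fst z) - snd z)" by blast
  show ?thesis
  proof
    show "f x \<le> p x" for x using order_trans[OF fq q(2)] .
    show "c \<le> f a" if "(a, c) \<in> A" for a c
      using order_trans[OF fq q(3)[OF that]] linear_neg[OF f, of a] by simp
  qed (rule f)
qed

text \<open>The ray of constraints generated by \<open>(d, p d)\<close> forces \<open>p d\<close> to
  be at most \<open>f d\<close>.\<close>

lemma linear_dominated_attaining:
  assumes p: "sublinear p"
  obtains f where "linear f" "\<And>x. f x \<le> p x" "f d = p d"
proof -
  let ?A = "{(t *\<^sub>R d, t * p d) | t. 0 \<le> t}"
  have "\<forall>(a, c)\<in>?A. c \<le> p a" by (auto simp: sublinear_scaleR_eq[OF p])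
  from linear_between_cone_and_sublinear[OF p cone_pairs_ray this]
  obtain f where f: "linear f" "\<And>x. f x \<le> p x" "\<And>a c. (a, c) \<in> ?A \<Longrightarrow> c \<le> f a" by blast
  have "(d, p d) \<in> ?A" by (auto intro!: exI[of _ 1])
  from f(3)[OF this] show ?thesis using that[of f] f(1,2) by (simp add: antisym)
qed

section \<open>The dual Banach lattice\<close>

text \<open>A copy of the type of bounded functionals: an order on \<open>'a \<Rightarrow>\<^sub>L real\<close> itself cannot be
  introduced as a type class instance, since the codomain is a fixed type.\<close>

typedef (overloaded) 'a dual = "UNIV :: ('a::real_normed_vector \<Rightarrow>\<^sub>L real) set"
  morphisms blinfun_of_dual dual_of_blinfun by simp

setup_lifting type_definition_dual

lift_definition dual_apply :: "'a::real_normed_vector dual \<Rightarrow> 'a \<Rightarrow> real" (infixl "\<cdot>" 75)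
  is blinfun_apply .

instantiation dual :: (real_normed_vector) real_normed_vector
begin

lift_definition zero_dual :: "'a dual" is 0 .
lift_definition plus_dual :: "'a dual \<Rightarrow> 'a dual \<Rightarrow> 'a dual" is "(+)" .
lift_definition minus_dual :: "'a dual \<Rightarrow> 'a dual \<Rightarrow> 'a dual" is "(-)" .
lift_definition uminus_dual :: "'a dual \<Rightarrow> 'a dual" is uminus .
lift_definition scaleR_dual :: "real \<Rightarrow> 'a dual \<Rightarrow> 'a dual" is scaleR .
lift_definition norm_dual :: "'a dual \<Rightarrow> real" is norm .

definition dist_dual :: "'a dual \<Rightarrow> 'a dual \<Rightarrow> real" where
  "dist_dual f g = norm (f - g)"

definition sgn_dual :: "'a dual \<Rightarrow> 'a dual" where
  "sgn_dual f = scaleR (inverse (norm f)) f"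

definition uniformity_dual :: "('a dual \<times> 'a dual) filter" where
  "uniformity_dual = (INF e\<in>{0<..}. principal {(f, g). dist f g < e})"

definition open_dual :: "'a dual set \<Rightarrow> bool" where
  "open_dual U = (\<forall>f\<in>U. \<forall>\<^sub>F (f', g) in uniformity. f' = f \<longrightarrow> g \<in> U)"

instance
proof
  fix f g h :: "'a dual" and s t :: real
  show "f + g + h = f + (g + h)" "f + g = g + f" "0 + f = f" "- f + f = 0" "f - g = f + - g"
    "t *\<^sub>R (f + g) = t *\<^sub>R f + t *\<^sub>R g" "(s + t) *\<^sub>R f = s *\<^sub>R f + t *\<^sub>R f"
    "s *\<^sub>R t *\<^sub>R f = (s * t) *\<^sub>R f" "1 *\<^sub>R f = f"
    "norm f = 0 \<longleftrightarrow> f = 0" "norm (t *\<^sub>R f) = \<bar>t\<bar> * norm f"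
    by (transfer; simp add: algebra_simps)+
  show "norm (f + g) \<le> norm f + norm g" by transfer (rule norm_triangle_ineq)
qed (rule dist_dual_def sgn_dual_def uniformity_dual_def open_dual_def)+

end

instance dual :: (real_normed_vector) banach
proof
  fix X :: "nat \<Rightarrow> 'a dual" assume "Cauchy X"
  have dist: "dist (blinfun_of_dual f) (blinfun_of_dual g) = dist f g" for f g :: "'a dual"
    by (simp add: dist_norm norm_dual.rep_eq minus_dual.rep_eq)
  have "Cauchy (\<lambda>n. blinfun_of_dual (X n))"
    using \<open>Cauchy X\<close> by (simp add: Cauchy_def dist)
  then obtain L where "(\<lambda>n. blinfun_of_dual (X n)) \<longlonglongrightarrow> L"
    using Cauchy_convergent convergentD by blast
  then have "(\<lambda>n. blinfun_of_dual (X n)) \<longlonglongrightarrow> blinfun_of_dual (dual_of_blinfun L)"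
    by (simp add: dual_of_blinfun_inverse)
  then have "X \<longlonglongrightarrow> dual_of_blinfun L"
    by (simp add: tendsto_dist_iff[of "\<lambda>n. blinfun_of_dual (X n)"] dist tendsto_dist_iff[of X])
  then show "convergent X" by (rule convergentI)
qed

lemma dual_apply_simps [simp]:
  "(f + g) \<cdot> x = f \<cdot> x + g \<cdot> x" "(f - g) \<cdot> x = f \<cdot> x - g \<cdot> x" "(- f) \<cdot> x = - (f \<cdot> x)"
  "0 \<cdot> x = 0" "(t *\<^sub>R f) \<cdot> x = t * (f \<cdot> x)"
  "f \<cdot> (x + y) = f \<cdot> x + f \<cdot> y" "f \<cdot> (x - y) = f \<cdot> x - f \<cdot> y" "f \<cdot> (- x) = - (f \<cdot> x)"
  "f \<cdot> 0 = 0" "f \<cdot> (t *\<^sub>R x) = t * (f \<cdot> x)"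
  by (transfer; simp add: blinfun.bilinear_simps)+

lemma dual_apply_sum: "f \<cdot> (\<Sum>i\<in>I. x i) = (\<Sum>i\<in>I. f \<cdot> x i)" "(\<Sum>i\<in>I. g i) \<cdot> y = (\<Sum>i\<in>I. g i \<cdot> y)"
  by (induction I rule: infinite_finite_induct) auto

lemma dual_eqI: "(\<And>x. f \<cdot> x = g \<cdot> x) \<Longrightarrow> f = g"
  by transfer (rule blinfun_eqI)

lemma abs_dual_apply_le: "\<bar>f \<cdot> x\<bar> \<le> norm f * norm x"
  using norm_blinfun[of "blinfun_of_dual f" x] by (simp add: dual_apply.rep_eq norm_dual.rep_eq)

lemma norm_dual_bound: "0 \<le> M \<Longrightarrow> (\<And>x. \<bar>f \<cdot> x\<bar> \<le> M * norm x) \<Longrightarrow> norm f \<le> M"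
  by (simp add: norm_dual.rep_eq dual_apply.rep_eq norm_blinfun_bound)

lemma tendsto_dual_apply: "(x \<longlongrightarrow> a) F \<Longrightarrow> ((\<lambda>i. f \<cdot> x i) \<longlongrightarrow> f \<cdot> a) F"
  by (simp add: dual_apply.rep_eq tendsto_intros)

lemma tendsto_dual_apply_left: "(f \<longlongrightarrow> g) F \<Longrightarrow> ((\<lambda>i. f i \<cdot> x) \<longlongrightarrow> g \<cdot> x) F"
proof -
  assume "(f \<longlongrightarrow> g) F"
  then have "((\<lambda>i. norm (f i - g) * norm x) \<longlongrightarrow> 0) F"
    by (intro tendsto_mult_left_zero) (simp add: LIM_zero tendsto_norm_zero)
  then have "((\<lambda>i. f i \<cdot> x - g \<cdot> x) \<longlongrightarrow> 0) F"
    by (rule Lim_null_comparison[rotated])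
      (use abs_dual_apply_le[of "f _ - g" x] in \<open>simp add: eventually_sequentially\<close>)
  then show ?thesis by (simp add: LIM_zero_iff)
qed

definition dual_of :: "('a::real_normed_vector \<Rightarrow> real) \<Rightarrow> 'a dual" where
  "dual_of f = dual_of_blinfun (Blinfun f)"

lemma dual_of_apply: "bounded_linear f \<Longrightarrow> dual_of f \<cdot> x = f x"
  by (simp add: dual_of_def dual_apply.rep_eq dual_of_blinfun_inverse bounded_linear_Blinfun_apply)

section \<open>Positive parts of functionals by the Riesz--Kantorovich formula\<close>

definition rk_sup :: "'a::banach_lattice dual \<Rightarrow> 'a \<Rightarrow> real" where
  "rk_sup f x = (SUP y\<in>{0..x}. f \<cdot> y)"

definition dual_pprt :: "'a::banach_lattice dual \<Rightarrow> 'a dual" where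
  "dual_pprt f = dual_of (\<lambda>x. rk_sup f (pprt x) - rk_sup f (pprt (- x)))"

context
  fixes f :: "'a::banach_lattice dual"
begin

lemma rk_sup_upper_bound: "y \<in> {0..x} \<Longrightarrow> f \<cdot> y \<le> norm f * norm x"
  by (rule order_trans[OF order_trans[OF abs_ge_self abs_dual_apply_le]])
    (simp add: mult_left_mono norm_mono)

lemma rk_sup_upper: "y \<in> {0..x} \<Longrightarrow> f \<cdot> y \<le> rk_sup f x"
  unfolding rk_sup_def by (rule cSUP_upper) (auto intro!: bdd_aboveI2 rk_sup_upper_bound)

lemma rk_sup_least: "0 \<le> x \<Longrightarrow> (\<And>y. y \<in> {0..x} \<Longrightarrow> f \<cdot> y \<le> b) \<Longrightarrow> rk_sup f x \<le> b"
  unfolding rk_sup_def by (rule cSUP_least) auto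

lemma rk_sup_nonneg: "0 \<le> x \<Longrightarrow> 0 \<le> rk_sup f x"
  using rk_sup_upper[of 0 x] by simp

text \<open>Riesz decomposition splits every element of the interval from 0 to x + y into elements
  of the intervals below x and below y, and conversely such elements add up to one below x +
  y.\<close>

lemma rk_sup_add:
  assumes x: "0 \<le> x" and y: "0 \<le> y"
  shows "rk_sup f (x + y) = rk_sup f x + rk_sup f y"
proof (rule antisym)
  show "rk_sup f (x + y) \<le> rk_sup f x + rk_sup f y"
  proof (rule rk_sup_least)
    fix z assume "z \<in> {0..x + y}"
    then obtain z1 z2 where z: "z = z1 + z2" "z1 \<in> {0..x}" "z2 \<in> {0..y}"
      using x y by (auto elim: riesz_decomposition[of z x y])
    then show "f \<cdot> z \<le> rk_sup f x + rk_sup f y"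
      using rk_sup_upper[of z1 x] rk_sup_upper[of z2 y] by simp
  qed (use x y in simp)
  have "f \<cdot> u + f \<cdot> v \<le> rk_sup f (x + y)" if "u \<in> {0..x}" "v \<in> {0..y}" for u v
    using rk_sup_upper[of "u + v" "x + y"] that by (simp add: add_mono)
  then have "rk_sup f x \<le> rk_sup f (x + y) - f \<cdot> v" if "v \<in> {0..y}" for v
    using x that by (intro rk_sup_least) (auto simp: algebra_simps)
  then have "rk_sup f y \<le> rk_sup f (x + y) - rk_sup f x"
    using y by (intro rk_sup_least) (auto simp: algebra_simps)
  then show "rk_sup f x + rk_sup f y \<le> rk_sup f (x + y)" by simp
qed

lemma rk_sup_scaleR_le:
  assumes "0 \<le> x" "0 < t"
  shows "rk_sup f (t *\<^sub>R x) \<le> t * rk_sup f x"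
proof (rule rk_sup_least)
  fix z assume z: "z \<in> {0..t *\<^sub>R x}"
  have "(1 / t) *\<^sub>R z \<le> (1 / t) *\<^sub>R t *\<^sub>R x" using z assms by (intro scaleR_left_mono) auto
  then have "(1 / t) *\<^sub>R z \<in> {0..x}" using z assms by (auto intro: scaleR_nonneg_nonneg)
  from rk_sup_upper[OF this] assms show "f \<cdot> z \<le> t * rk_sup f x" by (simp add: field_simps)
qed (use assms in \<open>simp add: scaleR_nonneg_nonneg\<close>)

lemma rk_sup_scaleR:
  assumes "0 \<le> x" "0 \<le> t"
  shows "rk_sup f (t *\<^sub>R x) = t * rk_sup f x"
proof (cases "t = 0")
  case True
  then show ?thesis using rk_sup_add[of 0 0] by simp
next
  case False
  then have t: "0 < t" using assms by simp
  have "0 \<le> t *\<^sub>R x" using assms by (simp add: scaleR_nonneg_nonneg)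
  from rk_sup_scaleR_le[OF this, of "1 / t"] t have "t * rk_sup f x \<le> rk_sup f (t *\<^sub>R x)"
    by (simp add: field_simps)
  then show ?thesis using rk_sup_scaleR_le[OF assms(1) t] by simp
qed

lemma dual_pprt_apply:
  "dual_pprt f \<cdot> x = rk_sup f (pprt x) - rk_sup f (pprt (- x))"
  unfolding dual_pprt_def
proof (rule dual_of_apply, rule bounded_linear_intro)
  let ?F = "\<lambda>x. rk_sup f (pprt x) - rk_sup f (pprt (- x))"
  \<comment> \<open>A representation a - b with positive a and b need not be the one by positive and
    negative parts. Additivity of \<open>rk_sup\<close> shows that it gives the same value, and this
    makes ?F additive.\<close>
  have diff: "?F (a - b) = rk_sup f a - rk_sup f b" if "0 \<le> a" "0 \<le> b" for a b
  proof -
    have "pprt (a - b) + b = a + pprt (- (a - b))"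
      using pprt_diff_pprt[of "a - b"] by (simp add: algebra_simps)
    then have "rk_sup f (pprt (a - b)) + rk_sup f b = rk_sup f a + rk_sup f (pprt (- (a - b)))"
      using that rk_sup_add by (metis zero_le_pprt)
    then show ?thesis by simp
  qed
  fix x y :: 'a and t :: real
  have "?F (x + y) = ?F ((pprt x + pprt y) - (pprt (- x) + pprt (- y)))"
    using pprt_diff_pprt[of x] pprt_diff_pprt[of y] by (metis add_diff_add)
  also have "\<dots> = ?F x + ?F y"
    by (subst diff) (simp_all add: rk_sup_add)
  finally show "?F (x + y) = ?F x + ?F y" .
  show "?F (t *\<^sub>R x) = t *\<^sub>R ?F x"
  proof (cases "0 \<le> t")
    case True
    then show ?thesis
      by (simp add: pprt_scaleR rk_sup_scaleR algebra_simps flip: scaleR_minus_right)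
  next
    case False
    have "rk_sup f (pprt (t *\<^sub>R x)) = - t * rk_sup f (pprt (- x))"
      using False pprt_scaleR[of "- t" "- x"] rk_sup_scaleR[of "pprt (- x)" "- t"] by simp
    moreover have "rk_sup f (pprt (- (t *\<^sub>R x))) = - t * rk_sup f (pprt x)"
      using False pprt_scaleR[of "- t" x] rk_sup_scaleR[of "pprt x" "- t"] by simp
    ultimately show ?thesis by (simp add: algebra_simps)
  qed
  have le: "rk_sup f (pprt z) \<le> norm f * norm z" for z
    by (rule rk_sup_least[OF zero_le_pprt])
      (meson rk_sup_upper_bound norm_ge_zero mult_left_mono norm_pprt_le order_trans)
  show "norm (?F x) \<le> norm x * norm f"
    using le[of x] le[of "- x"] rk_sup_nonneg[OF zero_le_pprt, of x] rk_sup_nonneg[OF zero_le_pprt, of "- x"]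
    by (simp add: abs_le_iff mult.commute)
qed

lemma dual_pprt_apply_nonneg: "0 \<le> x \<Longrightarrow> dual_pprt f \<cdot> x = rk_sup f x"
  using rk_sup_add[of 0 0] by (simp add: dual_pprt_apply pprt_eq_0)

end

section \<open>The order, the lattice operations and the lattice norm of the dual\<close>

instantiation dual :: (banach_lattice) lattice
begin

definition less_eq_dual :: "'a dual \<Rightarrow> 'a dual \<Rightarrow> bool" where
  "less_eq_dual f g \<longleftrightarrow> (\<forall>x\<ge>0. f \<cdot> x \<le> g \<cdot> x)"

definition less_dual :: "'a dual \<Rightarrow> 'a dual \<Rightarrow> bool" where
  "less_dual f g \<longleftrightarrow> f \<le> g \<and> \<not> g \<le> f"

definition sup_dual :: "'a dual \<Rightarrow> 'a dual \<Rightarrow> 'a dual" where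
  "sup_dual f g = g + dual_pprt (f - g)"

definition inf_dual :: "'a dual \<Rightarrow> 'a dual \<Rightarrow> 'a dual" where
  "inf_dual f g = f - dual_pprt (f - g)"

instance
proof
  fix f g h :: "'a dual"
  have upper: "k \<cdot> x \<le> dual_pprt k \<cdot> x" "0 \<le> dual_pprt k \<cdot> x" if "0 \<le> x" for k and x :: 'a
    using that rk_sup_upper[of x x k] rk_sup_upper[of 0 x k] by (simp_all add: dual_pprt_apply_nonneg)
  have least: "dual_pprt k \<cdot> x \<le> l \<cdot> x" if "\<And>x. 0 \<le> x \<Longrightarrow> k \<cdot> x \<le> l \<cdot> x" "\<And>x. 0 \<le> x \<Longrightarrow> 0 \<le> l \<cdot> x" "0 \<le> x" for k l and x :: 'a
  proof -
    have "k \<cdot> y \<le> l \<cdot> x" if "y \<in> {0..x}" for y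
      using \<open>y \<in> {0..x}\<close> \<open>\<And>x. 0 \<le> x \<Longrightarrow> k \<cdot> x \<le> l \<cdot> x\<close>[of y] \<open>\<And>x. 0 \<le> x \<Longrightarrow> 0 \<le> l \<cdot> x\<close>[of "x - y"] by simp
    then have "rk_sup k x \<le> l \<cdot> x" using \<open>0 \<le> x\<close> by (rule rk_sup_least[rotated])
    then show ?thesis using \<open>0 \<le> x\<close> by (simp add: dual_pprt_apply_nonneg)
  qed
  show "f < g \<longleftrightarrow> f \<le> g \<and> \<not> g \<le> f" by (rule less_dual_def)
  show "f \<le> f" by (simp add: less_eq_dual_def)
  show "f \<le> h" if "f \<le> g" "g \<le> h" using that by (auto simp: less_eq_dual_def intro: order_trans)
  show "f = g" if "f \<le> g" "g \<le> f"
  proof (rule dual_eqI)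
    fix x :: 'a
    have eq: "f \<cdot> pprt y = g \<cdot> pprt y" for y using that by (simp add: less_eq_dual_def antisym)
    have "f \<cdot> (pprt x - pprt (- x)) = g \<cdot> (pprt x - pprt (- x))" by (simp only: dual_apply_simps eq)
    then show "f \<cdot> x = g \<cdot> x" by (simp only: pprt_diff_pprt)
  qed
  show "inf f g \<le> f" using upper by (simp add: less_eq_dual_def inf_dual_def)
  show "inf f g \<le> g" using upper(1)[of _ "f - g"] by (simp add: less_eq_dual_def inf_dual_def algebra_simps)
  show "f \<le> inf g h" if "f \<le> g" "f \<le> h"
    using that least[of "g - h" "g - f"] by (simp add: less_eq_dual_def inf_dual_def algebra_simps)
  show "f \<le> sup f g" using upper(1)[of _ "f - g"] by (simp add: less_eq_dual_def sup_dual_def algebra_simps)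
  show "g \<le> sup f g" using upper by (simp add: less_eq_dual_def sup_dual_def)
  show "sup g h \<le> f" if "g \<le> f" "h \<le> f"
    using that least[of "g - h" "f - h"] by (simp add: less_eq_dual_def sup_dual_def algebra_simps)
qed

end

instance dual :: (banach_lattice) ordered_real_vector
  by standard (simp_all add: less_eq_dual_def mult_left_mono mult_right_mono)

instance dual :: (banach_lattice) lattice_ab_group_add ..

lemma dual_le_iff: "f \<le> g \<longleftrightarrow> (\<forall>x\<ge>0. f \<cdot> x \<le> g \<cdot> x)"
  by (rule less_eq_dual_def)

lemma dual_leI: "(\<And>x. 0 \<le> x \<Longrightarrow> f \<cdot> x \<le> g \<cdot> x) \<Longrightarrow> f \<le> g"
  by (simp add: less_eq_dual_def)

lemma dual_leD: "f \<le> g \<Longrightarrow> 0 \<le> x \<Longrightarrow> f \<cdot> x \<le> g \<cdot> x"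
  by (simp add: less_eq_dual_def)

lemma dual_nonneg: "0 \<le> f \<Longrightarrow> 0 \<le> x \<Longrightarrow> 0 \<le> f \<cdot> x"
  using dual_leD[of 0 f x] by simp

lemma dual_mono: "0 \<le> f \<Longrightarrow> x \<le> y \<Longrightarrow> f \<cdot> x \<le> f \<cdot> y"
  using dual_nonneg[of f "y - x"] by simp

lemma pprt_dual_apply: "0 \<le> x \<Longrightarrow> pprt f \<cdot> x = rk_sup f x"
  by (simp add: pprt_def sup_dual_def dual_pprt_apply_nonneg)

lemma lat_abs_dual_apply:
  assumes "0 \<le> x" shows "lat_abs f \<cdot> x = 2 * rk_sup f x - f \<cdot> x"
proof -
  have "lat_abs f = 2 *\<^sub>R pprt f - f"
    using pprt_diff_pprt[of f] by (simp add: lat_abs_eq scaleR_2 algebra_simps)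
  then show ?thesis using assms by (simp add: pprt_dual_apply)
qed

lemma abs_dual_apply_le_lat_abs: "\<bar>f \<cdot> x\<bar> \<le> lat_abs f \<cdot> lat_abs x"
proof -
  have le: "\<bar>f \<cdot> y\<bar> \<le> lat_abs f \<cdot> y" if "0 \<le> y" for y
    using dual_leD[OF le_lat_abs(1) that, of f] dual_leD[OF le_lat_abs(2) that, of f] by (simp add: abs_le_iff)
  have "\<bar>f \<cdot> x\<bar> = \<bar>f \<cdot> pprt x - f \<cdot> pprt (- x)\<bar>"
    by (simp only: pprt_diff_pprt flip: dual_apply_simps)
  also have "\<dots> \<le> \<bar>f \<cdot> pprt x\<bar> + \<bar>f \<cdot> pprt (- x)\<bar>" by simp
  also have "\<dots> \<le> lat_abs f \<cdot> lat_abs x"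
    using le[of "pprt x"] le[of "pprt (- x)"] by (simp add: lat_abs_eq[of x])
  finally show ?thesis .
qed

text \<open>If \<open>y\<close> runs through the order interval from \<open>0\<close> to \<open>x\<close>, then \<open>2y - x\<close> stays in the one from \<open>- x\<close> to \<open>x\<close>.\<close>

lemma lat_abs_dual_least:
  assumes x: "0 \<le> x" and b: "\<And>y. lat_abs y \<le> x \<Longrightarrow> f \<cdot> y \<le> b"
  shows "lat_abs f \<cdot> x \<le> b"
proof -
  have "rk_sup f x \<le> (b + f \<cdot> x) / 2"
  proof (rule rk_sup_least[OF x])
    fix y assume y: "y \<in> {0..x}"
    then have "lat_abs (y + y - x) \<le> x" by (auto simp: lat_abs_le_iff algebra_simps add_mono)
    from b[OF this] show "f \<cdot> y \<le> (b + f \<cdot> x) / 2" by simp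
  qed
  then show ?thesis using x by (simp add: lat_abs_dual_apply)
qed

text \<open>The chain is |f x| <= |f| (|x|) <= |g| (|x|) <= norm g * norm x. The last step holds
  because |g| at |x| is controlled by the values of g on vectors y with |y| <= |x|, whose norms are
  at most that of x.\<close>

instance dual :: (banach_lattice) banach_lattice
proof
  fix f g :: "'a dual" assume "sup f (- f) \<le> sup g (- g)"
  then have fg: "lat_abs f \<le> lat_abs g" by (simp add: lat_abs_def)
  show "norm f \<le> norm g"
  proof (rule norm_dual_bound)
    fix x
    have "\<bar>f \<cdot> x\<bar> \<le> lat_abs g \<cdot> lat_abs x"
      using abs_dual_apply_le_lat_abs[of f x] dual_leD[OF fg lat_abs_nonneg, of x] by simp
    also have "\<dots> \<le> norm g * norm x"
    proof (rule lat_abs_dual_least[OF lat_abs_nonneg])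
      fix y assume "lat_abs y \<le> lat_abs x"
      then have "norm y \<le> norm x" using norm_le_if_lat_abs_le[of y "lat_abs x"] by (simp add: norm_lat_abs)
      then show "g \<cdot> y \<le> norm g * norm x"
        by (meson abs_dual_apply_le abs_ge_self mult_left_mono norm_ge_zero order_trans)
    qed
    finally show "\<bar>f \<cdot> x\<bar> \<le> norm g * norm x" .
  qed simp
qed

section \<open>Infima of functionals, and agreement with the Riesz--Kantorovich formulas of the
  definitions\<close>

lemma inf_dual_apply_le:
  assumes "y \<in> {0..x}" shows "inf f g \<cdot> x \<le> f \<cdot> y + g \<cdot> (x - y)"
proof -
  have "inf f g \<cdot> y \<le> f \<cdot> y" "inf f g \<cdot> (x - y) \<le> g \<cdot> (x - y)"
    using assms by (intro dual_leD; simp)+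
  then show ?thesis by simp
qed

lemma inf_dual_apply_greatest:
  assumes x: "0 \<le> x" and b: "\<And>y. y \<in> {0..x} \<Longrightarrow> b \<le> f \<cdot> y + g \<cdot> (x - y)"
  shows "b \<le> inf f g \<cdot> x"
proof -
  have "rk_sup (f - g) x \<le> f \<cdot> x - b"
  proof (rule rk_sup_least[OF x])
    fix y assume "y \<in> {0..x}"
    \<comment> \<open>Replacing y by x - y turns the supremum for the positive part of f - g into
      the infimum that is wanted.\<close>
    then have "x - y \<in> {0..x}" by simp
    from b[OF this] show "(f - g) \<cdot> y \<le> f \<cdot> x - b" by simp
  qed
  then show ?thesis using x by (simp add: inf_dual_def dual_pprt_apply_nonneg)
qed

text \<open>The form in which smallness of an infimum is used later: for positive functionals it
  splits \<open>x\<close> into a part on which \<open>f\<close> is small and a part on which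
  \<open>g\<close> is small.\<close>

lemma inf_dual_apply_less:
  assumes "inf f g \<cdot> x < b" "0 \<le> x"
  obtains y where "y \<in> {0..x}" "f \<cdot> y + g \<cdot> (x - y) < b"
  using inf_dual_apply_greatest[of x b f g] assms by (meson not_le)

lemma dual_abs_pos_eq: "0 \<le> x \<Longrightarrow> dual_abs_pos (blinfun_of_dual f) x = lat_abs f \<cdot> x"
proof -
  assume x: "0 \<le> x"
  have le: "\<bar>f \<cdot> y\<bar> \<le> lat_abs f \<cdot> x" if "lat_abs y \<le> x" for y
    using abs_dual_apply_le_lat_abs[of f y] dual_mono[OF lat_abs_nonneg that, of f] by simp
  show ?thesis
    unfolding dual_abs_pos_def dual_apply.rep_eq[symmetric]
  proof (rule antisym)
    show "(SUP y\<in>{y. lat_abs y \<le> x}. \<bar>f \<cdot> y\<bar>) \<le> lat_abs f \<cdot> x"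
      using x le by (intro cSUP_least) (auto intro!: exI[of _ 0] simp: lat_abs_of_nonneg)
    show "lat_abs f \<cdot> x \<le> (SUP y\<in>{y. lat_abs y \<le> x}. \<bar>f \<cdot> y\<bar>)"
    proof (rule lat_abs_dual_least[OF x])
      fix y assume "lat_abs y \<le> x"
      then have "\<bar>f \<cdot> y\<bar> \<le> (SUP y\<in>{y. lat_abs y \<le> x}. \<bar>f \<cdot> y\<bar>)"
        using le by (intro cSUP_upper bdd_aboveI2) auto
      then show "f \<cdot> y \<le> (SUP y\<in>{y. lat_abs y \<le> x}. \<bar>f \<cdot> y\<bar>)" by simp
    qed
  qed
qed

lemma dual_inf_pos_eq:
  assumes x: "0 \<le> x"
  shows "dual_inf_pos (dual_abs_pos (blinfun_of_dual f)) (blinfun_of_dual u) x = inf (lat_abs f) u \<cdot> x"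
proof -
  have "dual_inf_pos (dual_abs_pos (blinfun_of_dual f)) (blinfun_of_dual u) x
      = (INF y\<in>{0..x}. lat_abs f \<cdot> y + u \<cdot> (x - y))"
    unfolding dual_inf_pos_def
    by (intro INF_cong) (auto simp: dual_abs_pos_eq dual_apply.rep_eq)
  also have "\<dots> = inf (lat_abs f) u \<cdot> x"
  proof (rule antisym)
    show "inf (lat_abs f) u \<cdot> x \<le> (INF y\<in>{0..x}. lat_abs f \<cdot> y + u \<cdot> (x - y))"
      using x by (intro cINF_greatest inf_dual_apply_le) auto
    show "(INF y\<in>{0..x}. lat_abs f \<cdot> y + u \<cdot> (x - y)) \<le> inf (lat_abs f) u \<cdot> x"
      using x by (intro inf_dual_apply_greatest cINF_lower bdd_belowI2[OF inf_dual_apply_le])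
  qed
  finally show ?thesis .
qed

lemma dual_abs_inf_eq: "dual_abs_inf (blinfun_of_dual f) (blinfun_of_dual u) x = inf (lat_abs f) u \<cdot> x"
proof -
  have "pos_part x = pprt x" "neg_part x = pprt (- x)" by (simp_all add: pos_part_def neg_part_def pprt_def)
  then have "dual_abs_inf (blinfun_of_dual f) (blinfun_of_dual u) x = inf (lat_abs f) u \<cdot> (pprt x - pprt (- x))"
    by (simp add: dual_abs_inf_def dual_ext_def dual_inf_pos_eq)
  then show ?thesis by (simp only: pprt_diff_pprt)
qed

section \<open>Positive functionals\<close>

text \<open>The linear functionals dominated by this one are exactly the positive functionals of
  norm at most one, so Hahn--Banach applied to it yields positive functionals directly.\<close>

lemma sublinear_norm_pprt: "sublinear (\<lambda>v::'a::banach_lattice. norm (pprt v))"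
  unfolding sublinear_def
proof (intro conjI allI impI)
  fix x y :: 'a and t :: real
  show "norm (pprt (x + y)) \<le> norm (pprt x) + norm (pprt y)"
    using norm_mono[OF zero_le_pprt pprt_add_le, of x y] norm_triangle_ineq order_trans by blast
  show "norm (pprt (t *\<^sub>R x)) \<le> t * norm (pprt x)" if "0 \<le> t"
    using that by (simp add: pprt_scaleR)
qed

lemma dual_of_dominated:
  fixes f :: "'a::banach_lattice \<Rightarrow> real"
  assumes lin: "linear f" and le: "\<And>x. f x \<le> norm (pprt x)"
  obtains F where "\<And>x. F \<cdot> x = f x" "0 \<le> F" "norm F \<le> 1"
proof -
  have neg: "f (- x) = - f x" for x using linear_neg[OF lin] by simp
  have bound: "\<bar>f x\<bar> \<le> norm x" for x
    using le[of x] le[of "- x"] norm_pprt_le[of x] norm_pprt_le[of "- x"] by (simp add: neg abs_le_iff)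
  have "bounded_linear f"
    using lin bound by (intro bounded_linear.intro bounded_linear_axioms.intro exI[of _ 1]) auto
  then have eq: "dual_of f \<cdot> x = f x" for x by (rule dual_of_apply)
  have "0 \<le> f x" if "0 \<le> x" for x
    using le[of "- x"] that by (simp add: neg pprt_eq_0)
  then have "0 \<le> dual_of f" by (simp add: dual_le_iff eq)
  moreover have "norm (dual_of f) \<le> 1" by (rule norm_dual_bound) (simp_all add: eq bound)
  ultimately show ?thesis using that eq by blast
qed

lemma exists_norming_functional:
  fixes d :: "'a::banach_lattice"
  obtains F where "0 \<le> F" "norm F \<le> 1" "norm (pprt d) \<le> F \<cdot> d"
proof -
  obtain f where f: "linear f" "\<And>x. f x \<le> norm (pprt x)" "f d = norm (pprt d)"
    using linear_dominated_attaining[OF sublinear_norm_pprt] by blast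
  then show ?thesis using dual_of_dominated[OF f(1,2)] that by (metis order_refl)
qed

lemma nonneg_if_dual_nonneg:
  fixes x :: "'a::banach_lattice"
  assumes "\<And>f. 0 \<le> f \<Longrightarrow> 0 \<le> f \<cdot> x"
  shows "0 \<le> x"
proof -
  obtain F where "0 \<le> F" "norm (pprt (- x)) \<le> F \<cdot> (- x)" by (rule exists_norming_functional)
  with assms[of F] have "norm (pprt (- x)) \<le> 0" by (simp del: norm_le_zero_iff)
  then have "pprt (- x) = 0" by simp
  then show ?thesis using le_zero_iff_zero_pprt[of "- x"] by simp
qed

text \<open>Hahn--Banach for the sublinear functional v -> f (v+), attained at \<open>x\<close>; the
  domination puts g between 0 and f. This serves to compare the supremum of two elements of E with
  an element of E''.\<close>

lemma exists_dual_apply_eq_pprt: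
  fixes f :: "'a::banach_lattice dual"
  assumes f: "0 \<le> f"
  obtains g where "0 \<le> g" "g \<le> f" "g \<cdot> x = f \<cdot> pprt x"
proof -
  have "sublinear (\<lambda>v. f \<cdot> pprt v)"
    unfolding sublinear_def using dual_mono[OF f pprt_add_le] by (auto simp: pprt_scaleR)
  then obtain h where h: "linear h" "\<And>v. h v \<le> f \<cdot> pprt v" "h x = f \<cdot> pprt x"
    using linear_dominated_attaining by blast
  have neg: "h (- v) = - h v" for v using linear_neg[OF h(1)] by simp
  have le: "f \<cdot> pprt v \<le> norm v * norm f" for v
    using abs_dual_apply_le[of f "pprt v"] mult_left_mono[OF norm_pprt_le[of v] norm_ge_zero[of f]]
    by (simp add: mult.commute)
  have "\<bar>h v\<bar> \<le> norm v * norm f" for v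
    using h(2)[of v] h(2)[of "- v"] le[of v] le[of "- v"] by (simp add: neg abs_le_iff)
  then have "bounded_linear h"
    using h(1) by (intro bounded_linear.intro bounded_linear_axioms.intro exI[of _ "norm f"]) auto
  then have eq: "dual_of h \<cdot> v = h v" for v by (rule dual_of_apply)
  show ?thesis
  proof
    show "0 \<le> dual_of h"
      unfolding dual_le_iff eq
    proof (intro allI impI)
      fix v :: 'a assume "0 \<le> v"
      then show "0 \<cdot> v \<le> h v" using h(2)[of "- v"] by (simp add: neg pprt_eq_0)
    qed
    show "dual_of h \<le> f"
      unfolding dual_le_iff eq by (metis h(2) pprt_eq_id)
    show "dual_of h \<cdot> x = f \<cdot> pprt x" by (simp add: eq h(3))
  qed
qed

text \<open>Monotonicity replaces Mazur's theorem here: if the norms stayed above \<open>\<delta>\<close>, then the upward closed cone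
  generated by the \<open>x n\<close> could be separated from the ball by one functional.\<close>

lemma decreasing_weakly_null_imp_null:
  fixes x :: "nat \<Rightarrow> 'a::banach_lattice"
  assumes dec: "decseq x" and nonneg: "\<And>n. 0 \<le> x n"
    and null: "\<And>f. 0 \<le> f \<Longrightarrow> (\<lambda>n. f \<cdot> x n) \<longlonglongrightarrow> 0"
  shows "x \<longlonglongrightarrow> 0"
proof -
  have small: "\<exists>n. norm (x n) < \<delta>" if \<delta>: "0 < \<delta>" for \<delta>
  proof (rule ccontr)
    assume "\<not> ?thesis"
    then have ge: "\<delta> \<le> norm (x n)" for n by (simp add: not_less)
    define A where "A = {(a, c). \<exists>t n. 0 \<le> t \<and> t *\<^sub>R x n \<le> a \<and> c \<le> t * \<delta>}"
    have "cone_pairs A"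
      unfolding cone_pairs_def
    proof (intro conjI ballI allI impI)
      show "0 \<in> A" by (auto simp: A_def zero_prod_def intro!: exI[of _ 0])
    next
      fix z w assume "z \<in> A" "w \<in> A"
      then obtain s t n m where s: "0 \<le> s" "s *\<^sub>R x n \<le> fst z" "snd z \<le> s * \<delta>"
        and t: "0 \<le> t" "t *\<^sub>R x m \<le> fst w" "snd w \<le> t * \<delta>" by (auto simp: A_def)
      \<comment> \<open>Because \<open>x\<close> decreases, the term with the larger index lies
        below both terms.\<close>
      have "s *\<^sub>R x (max n m) \<le> s *\<^sub>R x n" "t *\<^sub>R x (max n m) \<le> t *\<^sub>R x m"
        using dec s t by (auto simp: decseq_def intro!: scaleR_left_mono)
      then have "(s + t) *\<^sub>R x (max n m) \<le> fst (z + w)"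
        using s t by (auto simp: scaleR_add_left intro!: add_mono intro: order_trans)
      then show "z + w \<in> A"
        using s t by (auto simp: A_def case_prod_beta algebra_simps intro!: exI[of _ "s + t"] exI[of _ "max n m"])
    next
      fix s :: real and z assume s: "0 < s" and "z \<in> A"
      then obtain t n where t: "0 \<le> t" "t *\<^sub>R x n \<le> fst z" "snd z \<le> t * \<delta>" by (auto simp: A_def)
      have "s *\<^sub>R t *\<^sub>R x n \<le> s *\<^sub>R fst z" using s t by (intro scaleR_left_mono) auto
      then have "(s * t) *\<^sub>R x n \<le> s *\<^sub>R fst z" by simp
      moreover have "s * snd z \<le> s * t * \<delta>" using s t by simp
      ultimately show "s *\<^sub>R z \<in> A"
        using s t by (auto simp: A_def case_prod_beta intro!: exI[of _ "s * t"] exI[of _ n])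
    qed
    moreover have "\<forall>(a, c)\<in>A. c \<le> norm (pprt a)"
    proof clarify
      fix a c assume "(a, c) \<in> A"
      then obtain t n where t: "0 \<le> t" "t *\<^sub>R x n \<le> a" "c \<le> t * \<delta>" by (auto simp: A_def)
      have "c \<le> norm (t *\<^sub>R x n)" using t mult_left_mono[OF ge[of n] t(1)] by simp
      also have "\<dots> \<le> norm (pprt a)"
        using t nonneg by (intro norm_mono scaleR_nonneg_nonneg order_trans[OF t(2) le_pprt]) auto
      finally show "c \<le> norm (pprt a)" .
    qed
    ultimately obtain f where f: "linear f" "\<And>v. f v \<le> norm (pprt v)" "\<And>a c. (a, c) \<in> A \<Longrightarrow> c \<le> f a"
      using linear_between_cone_and_sublinear[OF sublinear_norm_pprt] by metis
    obtain F where F: "\<And>v. F \<cdot> v = f v" "0 \<le> F" using dual_of_dominated[OF f(1,2)] by metis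
    have "(x n, \<delta>) \<in> A" for n by (auto simp: A_def intro!: exI[of _ 1] exI[of _ n])
    then have "\<delta> \<le> F \<cdot> x n" for n using f(3) F(1) by simp
    then have "\<delta> \<le> 0" using null[OF F(2)] by (intro LIMSEQ_le_const) auto
    then show False using \<delta> by simp
  qed
  show ?thesis
  proof (rule LIMSEQ_I)
    fix \<delta> :: real assume "0 < \<delta>"
    then obtain N where N: "norm (x N) < \<delta>" using small by blast
    have "norm (x n - 0) < \<delta>" if "N \<le> n" for n
      using norm_mono[of "x n" "x N"] nonneg dec that N by (auto simp: decseq_def intro: le_less_trans)
    then show "\<exists>N. \<forall>n\<ge>N. norm (x n - 0) < \<delta>" by blast
  qed
qed

section \<open>KB-spaces\<close>

definition kb_space :: "'a::banach_lattice itself \<Rightarrow> bool" where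
  "kb_space _ \<longleftrightarrow> (\<forall>x::nat \<Rightarrow> 'a. incseq x \<longrightarrow> bounded (range x) \<longrightarrow> convergent x)"

lemma incseq_lattice_le_lim:
  fixes x :: "nat \<Rightarrow> 'a::banach_lattice"
  assumes "incseq x" "x \<longlonglongrightarrow> l" shows "x n \<le> l"
  using assms by (intro lattice_tendsto_le[OF tendsto_const assms(2), of n]) (auto simp: incseq_def)

lemma lattice_lim_le:
  fixes x :: "nat \<Rightarrow> 'a::banach_lattice"
  assumes "x \<longlonglongrightarrow> l" "\<And>n. x n \<le> b" shows "l \<le> b"
  using assms by (intro lattice_tendsto_le[OF assms(1) tendsto_const]) auto

lemma lattice_le_lim:
  fixes x :: "nat \<Rightarrow> 'a::banach_lattice"
  assumes "x \<longlonglongrightarrow> l" "\<And>n. b \<le> x n" shows "b \<le> l"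
  using assms by (intro lattice_tendsto_le[OF tendsto_const assms(1)]) auto

lemma bounded_order_interval: "bounded {0..v::'a::banach_lattice}"
  by (auto simp: bounded_iff intro!: exI[of _ "norm v"] norm_mono)

lemma kb_space_incseq_convergent:
  fixes x :: "nat \<Rightarrow> 'a::banach_lattice"
  assumes "kb_space TYPE('a)" "incseq x" "\<And>n. x n \<in> {0..v}"
  shows "convergent x"
proof -
  have "bounded (range x)" using assms(3) by (intro bounded_subset[OF bounded_order_interval[of v]]) auto
  then show ?thesis using assms by (simp add: kb_space_def)
qed

lemma kb_space_decseq_convergent:
  fixes x :: "nat \<Rightarrow> 'a::banach_lattice"
  assumes "kb_space TYPE('a)" "decseq x" "\<And>n. 0 \<le> x n"
  shows "convergent x"
proof -
  have "convergent (\<lambda>n. x 0 - x n)"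
    using assms
    by (intro kb_space_incseq_convergent[where v = "x 0"]) (auto simp: incseq_def decseq_def)
  from convergent_diff[OF convergent_const[of "x 0"] this] show ?thesis by simp
qed

text \<open>An upward directed bounded set has elements above which it hardly grows in norm. An
  increasing sequence of such elements, with tolerances tending to 0, converges to an upper bound of
  the whole set.\<close>

lemma kb_space_directed_sup:
  fixes D :: "'a::banach_lattice set"
  assumes kb: "kb_space TYPE('a)" and ne: "D \<noteq> {}" and bdd: "bounded D"
    and sup: "\<forall>a\<in>D. \<forall>b\<in>D. sup a b \<in> D"
  obtains s X where "\<forall>n. X n \<in> D" "X \<longlonglongrightarrow> s" "\<forall>d\<in>D. d \<le> s"
proof -
  have conv: "convergent X" if "\<And>n. X n \<in> D" "\<And>n. X n \<le> X (Suc n)" for X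
  proof -
    have "bounded (range X)" using bdd that(1) by (auto intro: bounded_subset)
    then show ?thesis using kb that(2) by (simp add: kb_space_def incseq_Suc_iff)
  qed
  \<comment> \<open>Otherwise one could climb inside \<open>D\<close> with steps longer than
    \<open>e\<close> forever, although increasing sequences in \<open>D\<close> converge.\<close>
  have ex: "\<exists>d\<in>D. \<forall>d'\<in>D. d \<le> d' \<longrightarrow> norm (d' - d) \<le> e" if e: "0 < e" for e
  proof (rule ccontr)
    assume "\<not> ?thesis"
    then have step: "\<And>d. d \<in> D \<Longrightarrow> \<exists>d'\<in>D. d \<le> d' \<and> e < norm (d' - d)" by (auto simp: not_le)
    obtain X where X: "\<And>n. X n \<in> D" "\<And>n. X n \<le> X (Suc n) \<and> e < norm (X (Suc n) - X n)"
      using dependent_nat_choice[of "\<lambda>_ d. d \<in> D" "\<lambda>_ d d'. d \<le> d' \<and> e < norm (d' - d)"] step ne by blast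
    obtain l where "X \<longlonglongrightarrow> l" using conv[of X] X by (auto simp: convergent_def)
    then have "(\<lambda>n. norm (X (Suc n) - X n)) \<longlonglongrightarrow> norm (l - l)"
      by (intro tendsto_norm tendsto_diff LIMSEQ_Suc)
    then have "e \<le> norm (l - l)" using X(2) by (intro LIMSEQ_le_const) (auto simp: less_imp_le)
    then show False using e by simp
  qed
  define P where "P n d \<longleftrightarrow> d \<in> D \<and> (\<forall>d'\<in>D. d \<le> d' \<longrightarrow> norm (d' - d) \<le> inverse (real (Suc n)))" for n d
  have "\<exists>X. \<forall>n. P n (X n) \<and> X n \<le> X (Suc n)"
  proof (rule dependent_nat_choice)
    show "\<exists>d. P 0 d" using ex[of 1] by (auto simp: P_def)
  next
    fix d n assume "P n d"
    obtain b where b: "b \<in> D" "\<And>d'. d' \<in> D \<Longrightarrow> b \<le> d' \<Longrightarrow> norm (d' - b) \<le> inverse (real (Suc (Suc n)))"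
      using ex[of "inverse (real (Suc (Suc n)))"] by auto
    \<comment> \<open>The tolerance is inherited by larger elements of \<open>D\<close>, so passing
      from \<open>b\<close> to \<open>sup b d\<close> keeps the sequence increasing.\<close>
    have "norm (d' - sup b d) \<le> inverse (real (Suc (Suc n)))" if "d' \<in> D" "sup b d \<le> d'" for d'
    proof -
      have "norm (d' - sup b d) \<le> norm (d' - b)"
        using that by (intro norm_mono diff_left_mono sup_ge1) (simp only: diff_ge_0_iff_ge)
      also have "\<dots> \<le> inverse (real (Suc (Suc n)))" using that by (intro b(2)) auto
      finally show ?thesis .
    qed
    then have "P (Suc n) (sup b d) \<and> d \<le> sup b d" using sup b \<open>P n d\<close> by (auto simp: P_def)
    then show "\<exists>y. P (Suc n) y \<and> d \<le> y" by blast
  qed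
  then obtain X where X: "\<And>n. P n (X n)" "\<And>n. X n \<le> X (Suc n)" by blast
  then have XD: "X n \<in> D" for n by (simp add: P_def)
  obtain s where s: "X \<longlonglongrightarrow> s" using conv[of X] X XD by (auto simp: convergent_def)
  have "d \<le> s" if d: "d \<in> D" for d
  proof -
    have "(\<lambda>n. sup d (X n) - X n) \<longlonglongrightarrow> sup d s - s" using s by (intro tendsto_intros tendsto_sup)
    \<comment> \<open>\<open>sup d (X n)\<close> is a member of \<open>D\<close> above
      \<open>X n\<close>, hence within the tolerance of \<open>X n\<close>.\<close>
    moreover have "(\<lambda>n. sup d (X n) - X n) \<longlonglongrightarrow> 0"
    proof (rule Lim_null_comparison[OF _ LIMSEQ_inverse_real_of_nat])
      show "\<forall>\<^sub>F n in sequentially. norm (sup d (X n) - X n) \<le> inverse (real (Suc n))"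
        using X(1) sup d XD by (auto simp: P_def)
    qed
    ultimately have "sup d s - s = 0" by (rule LIMSEQ_unique)
    then show ?thesis by (metis eq_iff_diff_eq_0 sup_ge1)
  qed
  then show ?thesis using that XD s by blast
qed

text \<open>The start value 0 is the supremum of no terms. For nonnegative \<open>z\<close> the
  value at \<open>m\<close> is the supremum of the first \<open>m\<close> terms.\<close>

primrec partial_sup :: "(nat \<Rightarrow> 'a::banach_lattice) \<Rightarrow> nat \<Rightarrow> 'a" where
  "partial_sup z 0 = 0"
| "partial_sup z (Suc m) = sup (partial_sup z m) (z m)"

lemma partial_sup_least: "0 \<le> b \<Longrightarrow> (\<And>j. j < m \<Longrightarrow> z j \<le> b) \<Longrightarrow> partial_sup z m \<le> b"
  by (induction m) auto

lemma partial_sup_upper: "j < m \<Longrightarrow> z j \<le> partial_sup z m"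
  by (induction m) (auto simp: less_Suc_eq intro: le_supI1)

lemma partial_sup_nonneg: "0 \<le> partial_sup z m"
  by (induction m) (auto intro: le_supI1)

lemma incseq_partial_sup: "incseq (partial_sup z)"
  by (simp add: incseq_Suc_iff)

lemma partial_sup_le_sum:
  assumes "\<And>j. 0 \<le> z j" shows "partial_sup z m \<le> (\<Sum>j<m. z j)"
proof (rule partial_sup_least)
  show "z j \<le> (\<Sum>j<m. z j)" if "j < m" for j
    using sum_mono2[of "{..<m}" "{j}" z] that assms by auto
qed (simp add: assms sum_nonneg)

text \<open>Here \<open>w k\<close> is the supremum of the tail of \<open>z\<close> from index
  \<open>k\<close>, a norm limit of partial suprema; \<open>w\<close> decreases, so it converges as
  well. The last clause is the estimate of the Borel--Cantelli argument: a positive functional is at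
  most the sum of its values on the tail, since partial suprema lie below partial sums.\<close>

lemma kb_space_limsup:
  fixes z :: "nat \<Rightarrow> 'a::banach_lattice"
  assumes kb: "kb_space TYPE('a)" and z: "\<And>j. z j \<in> {0..v}"
  obtains w where "convergent w" "\<forall>k. w k \<in> {0..v}" "\<forall>k. \<forall>j\<ge>k. z j \<le> w k"
    "\<forall>k \<alpha> c. 0 \<le> \<alpha> \<longrightarrow> (\<forall>m. (\<Sum>j<m. \<alpha> \<cdot> z (k + j)) \<le> c) \<longrightarrow> \<alpha> \<cdot> w k \<le> c"
proof -
  have v: "0 \<le> v" using z[of 0] by auto
  define W where "W k = partial_sup (\<lambda>j. z (k + j))" for k
  have W: "W k m \<in> {0..v}" for k m
    using z v by (auto simp: W_def partial_sup_nonneg intro!: partial_sup_least)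
  define w where "w k = lim (W k)" for k
  have lim: "W k \<longlonglongrightarrow> w k" for k
    using kb_space_incseq_convergent[OF kb, of "W k" v] W
    by (simp add: w_def W_def incseq_partial_sup convergent_LIMSEQ_iff del: atLeastAtMost_iff)
  have wv: "w k \<in> {0..v}" for k
    using lattice_lim_le[OF lim] lattice_le_lim[OF lim] W by auto
  have zw: "z j \<le> w k" if "k \<le> j" for j k
  proof -
    have "z (k + (j - k)) \<le> W k (Suc (j - k))"
      using partial_sup_upper[of "j - k" "Suc (j - k)" "\<lambda>j. z (k + j)"] by (simp add: W_def)
    also have "\<dots> \<le> w k" using lim by (intro incseq_lattice_le_lim) (auto simp: W_def incseq_partial_sup)
    finally show ?thesis using that by simp
  qed
  have "w (Suc k) \<le> w k" for k
    using zw wv by (intro lattice_lim_le[OF lim]) (auto simp: W_def intro!: partial_sup_least)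
  then have dec: "decseq w" by (simp add: decseq_Suc_iff)
  have "convergent w" using wv by (intro kb_space_decseq_convergent[OF kb dec]) auto
  moreover have "\<alpha> \<cdot> w k \<le> c" if \<alpha>: "0 \<le> \<alpha>" and c: "\<And>m. (\<Sum>j<m. \<alpha> \<cdot> z (k + j)) \<le> c" for k \<alpha> c
  proof (rule LIMSEQ_le_const2[OF tendsto_dual_apply[OF lim]])
    have "\<alpha> \<cdot> W k m \<le> c" for m
    proof -
      have "\<alpha> \<cdot> W k m \<le> \<alpha> \<cdot> (\<Sum>j<m. z (k + j))"
        unfolding W_def using z by (intro dual_mono[OF \<alpha>] partial_sup_le_sum) auto
      then show ?thesis using c[of m] by (simp add: dual_apply_sum)
    qed
    then show "\<exists>N. \<forall>m\<ge>N. \<alpha> \<cdot> W k m \<le> c" by blast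
  qed
  ultimately show ?thesis using that wv zw by blast
qed

lemma sum_half_powers_le: "(\<Sum>j<m. (1 / 2 :: real) ^ (k + j)) \<le> 2 * (1 / 2) ^ k"
proof -
  have "(\<Sum>j<m. (1 / 2 :: real) ^ (k + j)) = 2 * (1 / 2) ^ k - 2 * (1 / 2) ^ (k + m)"
    by (induction m) auto
  then show ?thesis by simp
qed

text \<open>Disjointness gives splittings of \<open>v\<close> with errors 2^-j. The limit superior
  of their first parts is an exact splitting: \<open>\<alpha>\<close> vanishes there by the summable
  bounds, and \<open>\<beta>\<close> vanishes on the complement because each tail supremum dominates
  all later parts.\<close>

lemma kb_space_disjoint_functionals:
  fixes \<alpha> \<beta> :: "'a::banach_lattice dual"
  assumes kb: "kb_space TYPE('a)" and \<alpha>: "0 \<le> \<alpha>" and \<beta>: "0 \<le> \<beta>" and disj: "inf \<alpha> \<beta> = 0" and v: "0 \<le> v"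
  obtains z where "z \<in> {0..v}" "\<alpha> \<cdot> z = 0" "\<beta> \<cdot> (v - z) = 0"
proof -
  have "\<exists>y\<in>{0..v}. \<alpha> \<cdot> y + \<beta> \<cdot> (v - y) < (1 / 2) ^ j" for j :: nat
    by (rule inf_dual_apply_less[of \<alpha> \<beta> v "(1 / 2) ^ j"]) (use v disj in auto)
  then obtain z where z: "\<And>j. z j \<in> {0..v}" and less: "\<And>j. \<alpha> \<cdot> z j + \<beta> \<cdot> (v - z j) < (1 / 2) ^ j"
    by metis
  have \<alpha>z: "\<alpha> \<cdot> z j \<le> (1 / 2) ^ j" and \<beta>z: "\<beta> \<cdot> (v - z j) \<le> (1 / 2) ^ j" for j
  proof -
    have "0 \<le> \<alpha> \<cdot> z j" "0 \<le> \<beta> \<cdot> (v - z j)" using z \<alpha> \<beta> by (auto intro!: dual_nonneg simp del: dual_apply_simps)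
    then show "\<alpha> \<cdot> z j \<le> (1 / 2) ^ j" "\<beta> \<cdot> (v - z j) \<le> (1 / 2) ^ j" using less[of j] by linarith+
  qed
  obtain w where w: "convergent w" "\<forall>k. w k \<in> {0..v}" "\<forall>k. \<forall>j\<ge>k. z j \<le> w k"
    and sum: "\<forall>k \<alpha> c. 0 \<le> \<alpha> \<longrightarrow> (\<forall>m. (\<Sum>j<m. \<alpha> \<cdot> z (k + j)) \<le> c) \<longrightarrow> \<alpha> \<cdot> w k \<le> c"
    by (rule kb_space_limsup[of z v, OF kb z]) (rule that)
  have half: "(\<lambda>j. (1 / 2 :: real) ^ j) \<longlonglongrightarrow> 0" by (rule LIMSEQ_power_zero) simp
  have \<alpha>w: "\<alpha> \<cdot> w k \<le> 2 * (1 / 2) ^ k" for k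
  proof (rule sum[rule_format, OF \<alpha>])
    fix m
    have "(\<Sum>j<m. \<alpha> \<cdot> z (k + j)) \<le> (\<Sum>j<m. (1 / 2) ^ (k + j))" by (intro sum_mono \<alpha>z)
    then show "(\<Sum>j<m. \<alpha> \<cdot> z (k + j)) \<le> 2 * (1 / 2) ^ k" using sum_half_powers_le[where k = k and m = m] by linarith
  qed
  have \<beta>w: "\<beta> \<cdot> (v - w k) \<le> 0" for k
  proof (rule LIMSEQ_le_const[OF half], intro exI[of _ k] allI impI)
    fix j assume "k \<le> j"
    then have "\<beta> \<cdot> (v - w k) \<le> \<beta> \<cdot> (v - z j)" using w(3) by (intro dual_mono[OF \<beta>] diff_left_mono) blast
    then show "\<beta> \<cdot> (v - w k) \<le> (1 / 2) ^ j" using \<beta>z[of j] by linarith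
  qed
  obtain l where l: "w \<longlonglongrightarrow> l" using w(1) by (auto simp: convergent_def)
  have lv: "l \<in> {0..v}" using lattice_lim_le[OF l, of v] lattice_le_lim[OF l, of 0] w(2) by simp
  have "\<alpha> \<cdot> l \<le> 2 * 0"
    by (rule LIMSEQ_le[OF tendsto_dual_apply[OF l] tendsto_mult[OF tendsto_const half]]) (use \<alpha>w in auto)
  moreover have "\<beta> \<cdot> (v - l) \<le> 0"
    by (rule LIMSEQ_le_const2[OF tendsto_dual_apply[OF tendsto_diff[OF tendsto_const l]]]) (use \<beta>w in blast)
  moreover have "0 \<le> \<alpha> \<cdot> l" "0 \<le> \<beta> \<cdot> (v - l)"
    using lv by (auto intro!: dual_nonneg \<alpha> \<beta> simp del: dual_apply_simps)
  ultimately have "\<alpha> \<cdot> l = 0" "\<beta> \<cdot> (v - l) = 0" by linarith+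
  then show ?thesis using that lv by blast
qed

text \<open>A greedy choice in which the condition on the next index may depend on all indices
  chosen before. The recursion carries the finite set of earlier indices together with the current
  one.\<close>

lemma select_subsequence:
  assumes ex: "\<And>k F N. finite F \<Longrightarrow> \<exists>m>N. Q k F m"
  obtains r :: "nat \<Rightarrow> nat" where "strict_mono r" "\<And>k. Q k (r ` {..<k}) (r k)"
proof -
  let ?P = "\<lambda>k S. finite (fst S) \<and> Q k (fst S) (snd S) \<and> (k = 0 \<longrightarrow> fst S = {})"
  let ?R = "\<lambda>k S S'. fst S' = insert (snd S) (fst S) \<and> snd S < (snd S' :: nat)"
  have "\<exists>S. \<forall>k. ?P k (S k) \<and> ?R k (S k) (S (Suc k))"
  proof (rule dependent_nat_choice)
    obtain m where "Q 0 {} m" using ex[of "{}"] by blast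
    then have "?P 0 ({}, m)" by simp
    then show "\<exists>S. ?P 0 S" by blast
  next
    fix S k assume S: "?P k S"
    then obtain m where "m > snd S" "Q (Suc k) (insert (snd S) (fst S)) m"
      using ex[of "insert (snd S) (fst S)" "snd S" "Suc k"] by auto
    then have "?P (Suc k) (insert (snd S) (fst S), m) \<and> ?R k S (insert (snd S) (fst S), m)" using S by simp
    then show "\<exists>S'. ?P (Suc k) S' \<and> ?R k S S'" by blast
  qed
  then obtain S where S: "\<And>k. ?P k (S k)" "\<And>k. ?R k (S k) (S (Suc k))" by blast
  define r where "r k = snd (S k)" for k
  have F: "fst (S k) = r ` {..<k}" for k
  proof (induction k)
    case 0
    then show ?case using S(1)[of 0] by simp
  next
    case (Suc k)
    then show ?case using S(2)[of k] by (simp add: r_def lessThan_Suc)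
  qed
  have "Q k (r ` {..<k}) (r k)" for k using S(1)[of k] by (simp add: F r_def)
  moreover have "strict_mono r" using S(2) by (simp add: r_def strict_mono_Suc_iff)
  ultimately show ?thesis using that by blast
qed

section \<open>The bidual\<close>

lemma bounded_linear_dual_apply: "bounded_linear (\<lambda>x. f \<cdot> x)"
  by (simp add: dual_apply.rep_eq blinfun.bounded_linear_right)

lemma bounded_linear_dual_apply_left: "bounded_linear (\<lambda>f. f \<cdot> x)"
  by (rule bounded_linear_intro[of _ "norm x"]) (use abs_dual_apply_le[of _ x] in auto)

definition bidual :: "'a::real_normed_vector \<Rightarrow> 'a dual dual" where
  "bidual x = dual_of (\<lambda>f. f \<cdot> x)"

lemma bidual_apply [simp]: "bidual x \<cdot> f = f \<cdot> x"
  by (simp add: bidual_def dual_of_apply bounded_linear_dual_apply_left)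

lemma bidual_nonneg: "0 \<le> x \<Longrightarrow> 0 \<le> bidual x"
  by (simp add: dual_le_iff dual_nonneg)

lemma bounded_linear_bidual: "bounded_linear bidual"
proof (rule bounded_linear_intro[of _ 1])
  fix x y :: 'a and t :: real
  show "bidual (x + y) = bidual x + bidual y" "bidual (t *\<^sub>R x) = t *\<^sub>R bidual x"
    by (rule dual_eqI; simp)+
  show "norm (bidual x) \<le> norm x * 1"
    by (rule norm_dual_bound) (use abs_dual_apply_le[of _ x] in \<open>auto simp: mult.commute\<close>)
qed

lemma bidual_of_blinfun:
  fixes \<Phi> :: "('a::real_normed_vector \<Rightarrow>\<^sub>L real) \<Rightarrow>\<^sub>L real"
  obtains \<phi> where "\<And>f. \<phi> \<cdot> f = blinfun_apply \<Phi> (blinfun_of_dual f)"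
proof
  have "bounded_linear (blinfun_of_dual :: 'a dual \<Rightarrow> _)"
    by (rule bounded_linear_intro[of _ 1])
      (simp_all add: plus_dual.rep_eq scaleR_dual.rep_eq norm_dual.rep_eq)
  then show "dual_of (\<lambda>f. blinfun_apply \<Phi> (blinfun_of_dual f)) \<cdot> f = blinfun_apply \<Phi> (blinfun_of_dual f)" for f
    by (intro dual_of_apply bounded_linear_compose[OF blinfun.bounded_linear_right])
qed

lemma blinfun_of_bidual:
  fixes \<phi> :: "'a::real_normed_vector dual dual"
  obtains \<Phi> where "\<And>f. blinfun_apply \<Phi> (blinfun_of_dual f) = \<phi> \<cdot> f"
proof
  have "bounded_linear (dual_of_blinfun :: _ \<Rightarrow> 'a dual)"
    by (rule bounded_linear_intro[of _ 1])
      (simp_all add: plus_dual.abs_eq scaleR_dual.abs_eq norm_dual.abs_eq)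
  then have "bounded_linear (\<lambda>g. \<phi> \<cdot> dual_of_blinfun g)"
    by (rule bounded_linear_compose[OF bounded_linear_dual_apply])
  then show "blinfun_apply (Blinfun (\<lambda>g. \<phi> \<cdot> dual_of_blinfun g)) (blinfun_of_dual f) = \<phi> \<cdot> f" for f
    by (simp add: bounded_linear_Blinfun_apply blinfun_of_dual_inverse)
qed

lemma blinfun_apply_canonical_embedding: "blinfun_apply (canonical_embedding x) f = blinfun_apply f x"
  by (simp add: canonical_embedding_def bounded_linear_Blinfun_apply blinfun.bounded_linear_left)

section \<open>The two properties restated for the type \<open>dual\<close>, and weak limits of
  increasing sequences\<close>

lemma reflexive_space_iff:
  "reflexive_space TYPE('a::real_normed_vector) \<longleftrightarrow> (\<forall>\<phi>::'a dual dual. \<exists>x. \<phi> = bidual x)"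
proof
  assume refl: "reflexive_space TYPE('a)"
  show "\<forall>\<phi>::'a dual dual. \<exists>x. \<phi> = bidual x"
  proof
    fix \<phi> :: "'a dual dual"
    obtain \<Phi> where \<Phi>: "\<And>f. blinfun_apply \<Phi> (blinfun_of_dual f) = \<phi> \<cdot> f" using blinfun_of_bidual by blast
    obtain x :: 'a where "\<Phi> = canonical_embedding x" using refl by (auto simp: reflexive_space_def surj_def)
    then have "\<phi> \<cdot> f = bidual x \<cdot> f" for f
      using \<Phi>[of f] by (simp add: blinfun_apply_canonical_embedding dual_apply.rep_eq[of f])
    then have "\<phi> = bidual x" by (rule dual_eqI)
    then show "\<exists>x. \<phi> = bidual x" by blast
  qed
next
  assume ex: "\<forall>\<phi>::'a dual dual. \<exists>x. \<phi> = bidual x"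
  have "\<exists>x. \<Phi> = canonical_embedding x" for \<Phi> :: "('a \<Rightarrow>\<^sub>L real) \<Rightarrow>\<^sub>L real"
  proof -
    obtain \<phi> where \<phi>: "\<And>f. \<phi> \<cdot> f = blinfun_apply \<Phi> (blinfun_of_dual f)" using bidual_of_blinfun by blast
    obtain x where "\<phi> = bidual x" using ex by blast
    then have "blinfun_apply \<Phi> f = blinfun_apply (canonical_embedding x) f" for f
      using \<phi>[of "dual_of_blinfun f"]
      by (simp add: blinfun_apply_canonical_embedding dual_apply.rep_eq[of "dual_of_blinfun f"] dual_of_blinfun_inverse)
    then show ?thesis by (auto intro: blinfun_eqI)
  qed
  then show "reflexive_space TYPE('a)" by (simp add: reflexive_space_def surj_def)
qed

lemma tendsto_dual_zero_if_nonneg: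
  fixes f :: "nat \<Rightarrow> 'a::banach_lattice dual"
  assumes "\<And>x. 0 \<le> x \<Longrightarrow> (\<lambda>n. f n \<cdot> x) \<longlonglongrightarrow> 0"
  shows "(\<lambda>n. f n \<cdot> x) \<longlonglongrightarrow> 0"
proof -
  have "(\<lambda>n. f n \<cdot> pprt x - f n \<cdot> pprt (- x)) \<longlonglongrightarrow> 0 - 0" by (intro tendsto_diff assms zero_le_pprt)
  then have "(\<lambda>n. f n \<cdot> (pprt x - pprt (- x))) \<longlonglongrightarrow> 0" by simp
  then show ?thesis by (simp only: pprt_diff_pprt)
qed

lemma unbounded_grothendieck_iff:
  "unbounded_grothendieck TYPE('a::banach_lattice) \<longleftrightarrow>
    (\<forall>f :: nat \<Rightarrow> 'a dual. bounded (range f) \<longrightarrow>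
      (\<forall>u x. 0 \<le> u \<longrightarrow> 0 \<le> x \<longrightarrow> (\<lambda>n. inf (lat_abs (f n)) u \<cdot> x) \<longlonglongrightarrow> 0) \<longrightarrow>
      (\<forall>\<phi>. (\<lambda>n. \<phi> \<cdot> f n) \<longlonglongrightarrow> 0))" (is "_ \<longleftrightarrow> (\<forall>f. ?P f)")
proof -
  have eq: "?P f \<longleftrightarrow> (bounded (range xs) \<longrightarrow> uaw_star_null xs \<longrightarrow> weakly_null_dual xs)"
    if xs: "xs = (\<lambda>n. blinfun_of_dual (f n))" for xs and f :: "nat \<Rightarrow> 'a dual"
  proof -
    have 1: "bounded (range xs) \<longleftrightarrow> bounded (range f)"
      by (simp add: xs bounded_iff norm_dual.rep_eq)
    have all: "(\<forall>v. Q v) \<longleftrightarrow> (\<forall>u. Q (blinfun_of_dual u))" for Q :: "('a \<Rightarrow>\<^sub>L real) \<Rightarrow> bool"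
      by (metis UNIV_I dual_of_blinfun_inverse)
    have pos: "dual_pos (blinfun_of_dual u) \<longleftrightarrow> 0 \<le> u" for u :: "'a dual"
      by (simp add: dual_pos_def dual_le_iff dual_apply.rep_eq zero_dual.rep_eq)
    have 2: "uaw_star_null xs \<longleftrightarrow>
        (\<forall>u x. 0 \<le> u \<longrightarrow> 0 \<le> x \<longrightarrow> (\<lambda>n. inf (lat_abs (f n)) u \<cdot> x) \<longlonglongrightarrow> 0)"
      unfolding uaw_star_null_def all[of "\<lambda>v. dual_pos v \<longrightarrow> _ v"] pos xs dual_abs_inf_eq
      using tendsto_dual_zero_if_nonneg[of "\<lambda>n. inf (lat_abs (f n)) u" for u] by blast
    have 3: "weakly_null_dual xs \<longleftrightarrow> (\<forall>\<phi>. (\<lambda>n. \<phi> \<cdot> f n) \<longlonglongrightarrow> 0)"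
    proof
      assume wn: "weakly_null_dual xs"
      show "\<forall>\<phi>. (\<lambda>n. \<phi> \<cdot> f n) \<longlonglongrightarrow> 0"
      proof
        fix \<phi> :: "'a dual dual"
        obtain \<Phi> where "\<And>f. blinfun_apply \<Phi> (blinfun_of_dual f) = \<phi> \<cdot> f" using blinfun_of_bidual by blast
        moreover have "(\<lambda>n. blinfun_apply \<Phi> (xs n)) \<longlonglongrightarrow> 0" using wn by (simp add: weakly_null_dual_def)
        ultimately show "(\<lambda>n. \<phi> \<cdot> f n) \<longlonglongrightarrow> 0" by (simp add: xs)
      qed
    next
      assume wn: "\<forall>\<phi>. (\<lambda>n. \<phi> \<cdot> f n) \<longlonglongrightarrow> 0"
      show "weakly_null_dual xs"
        unfolding weakly_null_dual_def
      proof
        fix \<Phi> :: "('a \<Rightarrow>\<^sub>L real) \<Rightarrow>\<^sub>L real"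
        obtain \<phi> where "\<And>f. \<phi> \<cdot> f = blinfun_apply \<Phi> (blinfun_of_dual f)" using bidual_of_blinfun by blast
        moreover have "(\<lambda>n. \<phi> \<cdot> f n) \<longlonglongrightarrow> 0" using wn by blast
        ultimately show "(\<lambda>n. blinfun_apply \<Phi> (xs n)) \<longlonglongrightarrow> 0" by (simp add: xs)
      qed
    qed
    show ?thesis unfolding 1 2 3 by (rule refl)
  qed
  show ?thesis
  proof
    assume "unbounded_grothendieck TYPE('a)"
    then show "\<forall>f. ?P f" unfolding unbounded_grothendieck_def using eq by blast
  next
    assume P: "\<forall>f. ?P f"
    show "unbounded_grothendieck TYPE('a)"
      unfolding unbounded_grothendieck_def
    proof
      fix xs :: "nat \<Rightarrow> 'a \<Rightarrow>\<^sub>L real"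
      have "xs = (\<lambda>n. blinfun_of_dual (dual_of_blinfun (xs n)))" by (simp add: dual_of_blinfun_inverse)
      from eq[OF this] P show "bounded (range xs) \<longrightarrow> uaw_star_null xs \<longrightarrow> weakly_null_dual xs" by blast
    qed
  qed
qed

text \<open>For positive f the numbers \<open>f \<cdot> x n\<close> increase and are bounded.
  Splitting f into its positive and negative part gives the limit for all f, and the norm bound on
  \<open>x\<close> makes it an element of E''.\<close>

lemma incseq_bounded_bidual_limit:
  fixes x :: "nat \<Rightarrow> 'a::banach_lattice"
  assumes inc: "incseq x" and bdd: "bounded (range x)"
  obtains \<phi> where "\<And>f. (\<lambda>n. f \<cdot> x n) \<longlonglongrightarrow> \<phi> \<cdot> f"
proof -
  obtain M where M: "\<And>n. norm (x n) \<le> M" using bdd by (auto simp: bounded_iff)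
  have le: "\<bar>f \<cdot> x n\<bar> \<le> norm f * M" for f n
    using abs_dual_apply_le[of f "x n"] mult_left_mono[OF M[of n] norm_ge_zero[of f]] by linarith
  have conv_pos: "convergent (\<lambda>n. f \<cdot> x n)" if "0 \<le> f" for f
  proof (rule Bseq_mono_convergent)
    show "Bseq (\<lambda>n. f \<cdot> x n)" using le[of f] by (intro BseqI') simp
    show "\<forall>m. \<forall>n\<ge>m. f \<cdot> x m \<le> f \<cdot> x n" using inc by (auto simp: incseq_def intro: dual_mono[OF that])
  qed
  have "convergent (\<lambda>n. f \<cdot> x n)" for f
  proof -
    have "convergent (\<lambda>n. pprt f \<cdot> x n - pprt (- f) \<cdot> x n)" by (intro convergent_diff conv_pos zero_le_pprt)
    then have "convergent (\<lambda>n. (pprt f - pprt (- f)) \<cdot> x n)" by simp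
    then show ?thesis by (simp only: pprt_diff_pprt)
  qed
  then have lim: "(\<lambda>n. f \<cdot> x n) \<longlonglongrightarrow> lim (\<lambda>n. f \<cdot> x n)" for f by (simp add: convergent_LIMSEQ_iff)
  have "bounded_linear (\<lambda>f. lim (\<lambda>n. f \<cdot> x n))"
  proof (rule bounded_linear_intro[of _ M])
    fix f g :: "'a dual" and t :: real
    have "(\<lambda>n. (f + g) \<cdot> x n) \<longlonglongrightarrow> lim (\<lambda>n. f \<cdot> x n) + lim (\<lambda>n. g \<cdot> x n)"
      using tendsto_add[OF lim lim, of f g] by simp
    then show "lim (\<lambda>n. (f + g) \<cdot> x n) = lim (\<lambda>n. f \<cdot> x n) + lim (\<lambda>n. g \<cdot> x n)" by (rule limI)
    have "(\<lambda>n. (t *\<^sub>R f) \<cdot> x n) \<longlonglongrightarrow> t *\<^sub>R lim (\<lambda>n. f \<cdot> x n)"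
      using tendsto_mult_left[OF lim, of t f] by simp
    then show "lim (\<lambda>n. (t *\<^sub>R f) \<cdot> x n) = t *\<^sub>R lim (\<lambda>n. f \<cdot> x n)" by (rule limI)
    have "(\<lambda>n. \<bar>f \<cdot> x n\<bar>) \<longlonglongrightarrow> \<bar>lim (\<lambda>n. f \<cdot> x n)\<bar>" using lim by (rule tendsto_rabs)
    then show "norm (lim (\<lambda>n. f \<cdot> x n)) \<le> norm f * M" using le[of f] by (auto intro: LIMSEQ_le_const2)
  qed
  then have "dual_of (\<lambda>f. lim (\<lambda>n. f \<cdot> x n)) \<cdot> f = lim (\<lambda>n. f \<cdot> x n)" for f by (rule dual_of_apply)
  then show ?thesis using that[of "dual_of (\<lambda>f. lim (\<lambda>n. f \<cdot> x n))"] lim by simp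
qed

section \<open>Reflexive Banach lattices have the unbounded Grothendieck property\<close>

text \<open>Reflexivity turns the limit in E'' into a vector \<open>a\<close>. The differences
  \<open>a - x n\<close> are positive, decreasing and weakly null, hence norm null.\<close>

lemma reflexive_imp_kb_space:
  assumes refl: "reflexive_space TYPE('a::banach_lattice)"
  shows "kb_space TYPE('a)"
  unfolding kb_space_def
proof (intro allI impI)
  fix x :: "nat \<Rightarrow> 'a" assume inc: "incseq x" and bdd: "bounded (range x)"
  obtain \<phi> where "\<And>f. (\<lambda>n. f \<cdot> x n) \<longlonglongrightarrow> \<phi> \<cdot> f"
    using incseq_bounded_bidual_limit[OF inc bdd] by blast
  moreover obtain a where "\<phi> = bidual a" using refl by (auto simp: reflexive_space_iff)
  ultimately have lim: "(\<lambda>n. f \<cdot> x n) \<longlonglongrightarrow> f \<cdot> a" for f by simp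
  have "0 \<le> a - x n" for n
  proof (rule nonneg_if_dual_nonneg)
    fix f :: "'a dual" assume "0 \<le> f"
    then have "f \<cdot> x n \<le> f \<cdot> x m" if "n \<le> m" for m using inc that by (auto simp: incseq_def intro: dual_mono)
    then show "0 \<le> f \<cdot> (a - x n)" using LIMSEQ_le_const[OF lim, of "f \<cdot> x n" f] by auto
  qed
  moreover have "decseq (\<lambda>n. a - x n)" using inc by (simp add: incseq_def decseq_def)
  moreover have "(\<lambda>n. f \<cdot> (a - x n)) \<longlonglongrightarrow> 0" for f
    using tendsto_diff[OF tendsto_const lim, of "f \<cdot> a" f] by simp
  ultimately have "(\<lambda>n. a - x n) \<longlonglongrightarrow> 0" by (intro decreasing_weakly_null_imp_null)
  from tendsto_diff[OF tendsto_const[of a] this] show "convergent x" by (auto simp: convergent_def)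
qed

lemma kb_space_uaw_null_imp_null:
  fixes h :: "nat \<Rightarrow> 'a::banach_lattice dual"
  assumes kb: "kb_space TYPE('a)" and h: "\<And>n. 0 \<le> h n" and bdd: "bounded (range h)"
    and null: "\<And>u. 0 \<le> u \<Longrightarrow> (\<lambda>n. inf (h n) u \<cdot> x) \<longlonglongrightarrow> 0" and x: "0 \<le> x"
  shows "(\<lambda>n. h n \<cdot> x) \<longlonglongrightarrow> 0"
proof (rule ccontr)
  assume "\<not> ?thesis"
  then obtain \<delta> where \<delta>: "0 < \<delta>" and "\<And>N. \<exists>n\<ge>N. \<delta> \<le> h n \<cdot> x"
    using dual_nonneg[OF h x] by (auto simp: LIMSEQ_iff not_less)
  then have freq: "\<exists>n>N. M \<le> n \<and> \<delta> \<le> h n \<cdot> x" for N M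
    by (metis Suc_le_eq max.bounded_iff)
  \<comment> \<open>The next functional is still large at \<open>x\<close>, but almost disjoint at
    \<open>x\<close> from 2^k times the sum of all earlier ones. The factor 2^k later produces
    summable errors.\<close>
  let ?Q = "\<lambda>k F m. \<delta> \<le> h m \<cdot> x \<and> inf (h m) (2 ^ k *\<^sub>R (\<Sum>i\<in>F. h i)) \<cdot> x < \<delta> / 4"
  have ex: "\<exists>m>N. ?Q k F m" for k N :: nat and F :: "nat set"
  proof -
    have "(\<lambda>n. inf (h n) (2 ^ k *\<^sub>R (\<Sum>i\<in>F. h i)) \<cdot> x) \<longlonglongrightarrow> 0"
      by (intro null scaleR_nonneg_nonneg sum_nonneg h) simp
    then obtain M where "\<And>n. M \<le> n \<Longrightarrow> inf (h n) (2 ^ k *\<^sub>R (\<Sum>i\<in>F. h i)) \<cdot> x < \<delta> / 4"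
      using order_tendstoD(2)[of _ 0 sequentially "\<delta> / 4"] \<delta> by (auto simp: eventually_sequentially)
    with freq[of N M] show ?thesis by blast
  qed
  obtain r where r: "strict_mono r" "\<And>k. ?Q k (r ` {..<k}) (r k)"
    using select_subsequence[of ?Q, OF ex] by blast
  define g where "g k = h (r k)" for k
  have g: "0 \<le> g k" "\<delta> \<le> g k \<cdot> x" for k using h r by (auto simp: g_def)
  have "(\<Sum>i\<in>r ` {..<k}. h i) = (\<Sum>i<k. g i)" for k
    using strict_mono_imp_inj_on[OF r(1)] by (subst sum.reindex) (auto simp: g_def intro: inj_on_subset)
  then have "inf (g k) (2 ^ k *\<^sub>R (\<Sum>i<k. g i)) \<cdot> x < \<delta> / 4" for k using r(2)[of k] by (simp add: g_def)
  then have "\<exists>y\<in>{0..x}. g k \<cdot> y + (2 ^ k *\<^sub>R (\<Sum>i<k. g i)) \<cdot> (x - y) < \<delta> / 4" for k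
    using x by (meson inf_dual_apply_less)
  then obtain y where y: "\<And>k. y k \<in> {0..x}" "\<And>k. g k \<cdot> y k + (2 ^ k *\<^sub>R (\<Sum>i<k. g i)) \<cdot> (x - y k) < \<delta> / 4"
    by metis
  \<comment> \<open>The part \<open>z k\<close> of \<open>x\<close> carries most of
    \<open>g k\<close>, while all earlier \<open>g i\<close> are at most \<delta>/4 * 2^-k on
    it.\<close>
  define z where "z k = x - y k" for k
  have z: "z k \<in> {0..x}" for k using y(1)[of k] by (simp add: z_def)
  have less: "g k \<cdot> (x - z k) + 2 ^ k * (\<Sum>i<k. g i \<cdot> z k) < \<delta> / 4" for k
  proof -
    have "x - z k = y k" by (simp add: z_def)
    moreover have "(2 ^ k *\<^sub>R (\<Sum>i<k. g i)) \<cdot> z k = 2 ^ k * (\<Sum>i<k. g i \<cdot> z k)"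
      by (simp only: dual_apply_simps dual_apply_sum)
    ultimately show ?thesis using y(2)[of k] by (simp only: z_def)
  qed
  have gz_nonneg: "0 \<le> g i \<cdot> z k" for i k using z[of k] by (intro dual_nonneg g) simp
  have gz: "\<delta> * (3 / 4) \<le> g k \<cdot> z k" for k
  proof -
    have "0 \<le> 2 ^ k * (\<Sum>i<k. g i \<cdot> z k)" by (intro mult_nonneg_nonneg sum_nonneg gz_nonneg) simp
    then show ?thesis using less[of k] g(2)[of k] by simp
  qed
  have gz_small: "g i \<cdot> z k \<le> \<delta> / 4 * (1 / 2) ^ k" if "i < k" for i k
  proof -
    have "g i \<cdot> z k \<le> (\<Sum>i<k. g i \<cdot> z k)" using that by (intro member_le_sum gz_nonneg) auto
    then have "2 ^ k * (g i \<cdot> z k) \<le> 2 ^ k * (\<Sum>i<k. g i \<cdot> z k)" by (intro mult_left_mono) simp_all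
    moreover have "0 \<le> g k \<cdot> (x - z k)" using z[of k] by (intro dual_nonneg g) simp
    ultimately have "2 ^ k * (g i \<cdot> z k) < \<delta> / 4" using less[of k] by linarith
    then show ?thesis by (simp add: field_simps)
  qed
  obtain w where w: "convergent w" "\<forall>k. w k \<in> {0..x}" "\<forall>k. \<forall>j\<ge>k. z j \<le> w k"
    and sum: "\<forall>k \<alpha> c. 0 \<le> \<alpha> \<longrightarrow> (\<forall>m. (\<Sum>j<m. \<alpha> \<cdot> z (k + j)) \<le> c) \<longrightarrow> \<alpha> \<cdot> w k \<le> c"
    by (rule kb_space_limsup[of z x, OF kb z]) (rule that)
  obtain M where M: "\<And>n. norm (h n) \<le> M" using bdd by (auto simp: bounded_iff)
  \<comment> \<open>\<open>g k\<close> is at least 3\<delta>/4 on \<open>w k\<close>, which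
    dominates \<open>z k\<close>, and at most \<delta>/4 on \<open>w (Suc k)\<close>, which involves
    only later \<open>z j\<close>. So consecutive tail suprema stay apart, contrary to their
    convergence.\<close>
  have "\<delta> / 2 \<le> M * norm (w k - w (Suc k))" for k
  proof -
    have "g k \<cdot> w (Suc k) \<le> \<delta> / 4"
    proof (rule sum[rule_format, OF g(1)])
      fix m
      have "(\<Sum>j<m. g k \<cdot> z (Suc k + j)) \<le> (\<Sum>j<m. \<delta> / 4 * (1 / 2) ^ (Suc k + j))"
        by (intro sum_mono gz_small) simp
      also have "\<dots> \<le> \<delta> / 4 * (2 * (1 / 2) ^ Suc k)"
        unfolding sum_distrib_left[symmetric] using \<delta> by (intro mult_left_mono sum_half_powers_le) simp
      also have "\<dots> \<le> \<delta> / 4 * 1" using \<delta> by (intro mult_left_mono) (simp_all add: power_le_one)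
      finally show "(\<Sum>j<m. g k \<cdot> z (Suc k + j)) \<le> \<delta> / 4" by simp
    qed
    moreover have "\<delta> * (3 / 4) \<le> g k \<cdot> w k" using gz[of k] dual_mono[OF g(1) w(3)[rule_format, of k k], of k] by simp
    ultimately have "\<delta> / 2 \<le> g k \<cdot> (w k - w (Suc k))" by simp
    also have "\<dots> \<le> norm (g k) * norm (w k - w (Suc k))" by (rule abs_le_D1[OF abs_dual_apply_le])
    also have "\<dots> \<le> M * norm (w k - w (Suc k))" unfolding g_def by (intro mult_right_mono M) simp
    finally show ?thesis .
  qed
  moreover have "(\<lambda>k. M * norm (w k - w (Suc k))) \<longlonglongrightarrow> M * 0"
  proof -
    obtain l where l: "w \<longlonglongrightarrow> l" using w(1) by (auto simp: convergent_def)
    have "(\<lambda>k. M * norm (w k - w (Suc k))) \<longlonglongrightarrow> M * norm (l - l)"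
      by (intro tendsto_intros l LIMSEQ_Suc)
    then show ?thesis by simp
  qed
  ultimately have "\<delta> / 2 \<le> M * 0" by (intro LIMSEQ_le_const) auto
  then show False using \<delta> by simp
qed

lemma reflexive_imp_unbounded_grothendieck:
  assumes refl: "reflexive_space TYPE('a::banach_lattice)"
  shows "unbounded_grothendieck TYPE('a)"
  unfolding unbounded_grothendieck_iff
proof (intro allI impI)
  fix f :: "nat \<Rightarrow> 'a dual" and \<phi> :: "'a dual dual"
  assume bdd: "bounded (range f)"
    and null: "\<forall>u x. 0 \<le> u \<longrightarrow> 0 \<le> x \<longrightarrow> (\<lambda>n. inf (lat_abs (f n)) u \<cdot> x) \<longlonglongrightarrow> 0"
  obtain x where x: "\<phi> = bidual x" using refl by (auto simp: reflexive_space_iff)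
  have "bounded (range (\<lambda>n. lat_abs (f n)))" using bdd by (simp add: bounded_iff norm_lat_abs)
  then have "(\<lambda>n. lat_abs (f n) \<cdot> lat_abs x) \<longlonglongrightarrow> 0"
    by (rule kb_space_uaw_null_imp_null[OF reflexive_imp_kb_space[OF refl] lat_abs_nonneg])
      (simp_all add: null lat_abs_nonneg)
  then have "(\<lambda>n. f n \<cdot> x) \<longlonglongrightarrow> 0"
    by (rule Lim_null_comparison[rotated]) (simp add: abs_dual_apply_le_lat_abs)
  then show "(\<lambda>n. \<phi> \<cdot> f n) \<longlonglongrightarrow> 0" by (simp add: x)
qed

section \<open>The unbounded Grothendieck property implies reflexivity\<close>

lemma unbounded_grothendieckD:
  fixes f :: "nat \<Rightarrow> 'a::banach_lattice dual"
  assumes "unbounded_grothendieck TYPE('a)" "bounded (range f)" "\<And>n. 0 \<le> f n"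
    and "\<And>u x. 0 \<le> u \<Longrightarrow> 0 \<le> x \<Longrightarrow> (\<lambda>n. inf (f n) u \<cdot> x) \<longlonglongrightarrow> 0"
  shows "(\<lambda>n. \<phi> \<cdot> f n) \<longlonglongrightarrow> 0"
proof -
  have "lat_abs (f n) = f n" for n using assms(3) by (rule lat_abs_of_nonneg)
  with assms(1)[unfolded unbounded_grothendieck_iff, rule_format, of f \<phi>] assms(2,4) show ?thesis by simp
qed

lemma unbounded_grothendieck_imp_kb_space_dual:
  assumes ug: "unbounded_grothendieck TYPE('a::banach_lattice)"
  shows "kb_space TYPE('a dual)"
  unfolding kb_space_def
proof (intro allI impI)
  fix f :: "nat \<Rightarrow> 'a dual" assume inc: "incseq f" and bdd: "bounded (range f)"
  obtain \<Psi> where \<Psi>: "\<And>F. (\<lambda>n. F \<cdot> f n) \<longlonglongrightarrow> \<Psi> \<cdot> F"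
    using incseq_bounded_bidual_limit[OF inc bdd] by blast
  \<comment> \<open>The pointwise limit of \<open>f\<close> is the limit in the bidual of E',
    restricted to the canonical image of E.\<close>
  define g where "g = dual_of (\<lambda>x. \<Psi> \<cdot> bidual x)"
  have "bounded_linear (\<lambda>x. \<Psi> \<cdot> bidual x)"
    by (rule bounded_linear_compose[OF bounded_linear_dual_apply bounded_linear_bidual])
  then have lim: "(\<lambda>n. f n \<cdot> x) \<longlonglongrightarrow> g \<cdot> x" for x
    using \<Psi>[of "bidual x"] by (simp add: g_def dual_of_apply)
  have mono: "f n \<cdot> x \<le> f m \<cdot> x" if "n \<le> m" "0 \<le> x" for n m x
    using inc that by (auto simp: incseq_def intro: dual_leD)
  have nonneg: "0 \<le> g - f n" for n
  proof -
    have "f n \<cdot> x \<le> g \<cdot> x" if "0 \<le> x" for x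
      using mono[of n _ x] that by (intro LIMSEQ_le_const[OF lim]) auto
    then show ?thesis by (simp add: dual_le_iff)
  qed
  have diff: "(\<lambda>n. (g - f n) \<cdot> x) \<longlonglongrightarrow> 0" for x
    using tendsto_diff[OF tendsto_const lim, of "g \<cdot> x" x] by simp
  have null: "(\<lambda>n. \<phi> \<cdot> (g - f n)) \<longlonglongrightarrow> 0" for \<phi>
  proof (rule unbounded_grothendieckD[OF ug _ nonneg])
    obtain M where "\<And>n. norm (f n) \<le> M" using bdd by (auto simp: bounded_iff)
    then have "norm (g - f n) \<le> norm g + M" for n by (meson add_left_mono norm_triangle_ineq4 order_trans)
    then show "bounded (range (\<lambda>n. g - f n))" by (auto simp: bounded_iff)
    show "(\<lambda>n. inf (g - f n) u \<cdot> x) \<longlonglongrightarrow> 0" if "0 \<le> u" "0 \<le> x" for u x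
    proof (rule tendsto_sandwich[OF _ _ tendsto_const diff])
      show "\<forall>\<^sub>F n in sequentially. 0 \<le> inf (g - f n) u \<cdot> x"
        using that nonneg by (intro always_eventually allI dual_nonneg le_infI)
      show "\<forall>\<^sub>F n in sequentially. inf (g - f n) u \<cdot> x \<le> (g - f n) \<cdot> x"
        using that by (intro always_eventually allI dual_leD inf_le1)
    qed
  qed
  have "decseq (\<lambda>n. g - f n)" using inc by (simp add: incseq_def decseq_def)
  then have "(\<lambda>n. g - f n) \<longlonglongrightarrow> 0" by (rule decreasing_weakly_null_imp_null[OF _ nonneg null])
  from tendsto_diff[OF tendsto_const[of g] this] show "convergent f" by (auto simp: convergent_def)
qed

text \<open>For disjoint \<open>g k\<close> the sum of the truncations would be their supremum,
  which is at most \<open>u\<close>. Adding the N-th truncation to the supremum of the earlier ones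
  costs only their infimum, and \<open>inf_pprt_diff_scaleR_le\<close> bounds this overlap by 2^-N
  times \<open>G N\<close>.\<close>

lemma almost_disjoint_sum_inf_le:
  fixes G :: "nat \<Rightarrow> 'a::banach_lattice"
  assumes G: "\<And>k. 0 \<le> G k" and u: "0 \<le> u"
    and g: "\<And>k. g k = pprt (G k - 2 ^ k *\<^sub>R (\<Sum>i<k. G i))"
  shows "(\<Sum>k<N. inf (g k) u) \<le> u + (\<Sum>k<N. (1 / 2) ^ k *\<^sub>R G k)"
proof -
  define a where "a k = inf (g k) u" for k
  have a: "0 \<le> a k" "a k \<le> g k" "a k \<le> u" for k using u by (auto simp: a_def g)
  have S: "0 \<le> (\<Sum>i<k. G i)" for k by (simp add: G sum_nonneg)
  have gG: "g k \<le> G k" for k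
    unfolding g using G S by (intro pprt_least) (auto simp: scaleR_nonneg_nonneg)
  have "(\<Sum>k<N. a k) \<le> partial_sup a N + (\<Sum>k<N. (1 / 2) ^ k *\<^sub>R G k)"
  proof (induction N)
    case (Suc N)
    have "partial_sup a N \<le> (\<Sum>i<N. a i)" using a by (intro partial_sup_le_sum)
    also have "\<dots> \<le> (\<Sum>i<N. G i)" using a gG by (intro sum_mono) (rule order_trans)
    finally have "inf (partial_sup a N) (a N) \<le> inf (g N) (\<Sum>i<N. G i)"
      using a(2)[of N] by (simp add: le_infI1 le_infI2)
    also have "\<dots> \<le> (1 / 2) ^ N *\<^sub>R G N"
      using inf_pprt_diff_scaleR_le[OF G S, of "2 ^ N" N N] by (simp add: g power_one_over)
    finally have step: "partial_sup a N + a N \<le> partial_sup a (Suc N) + (1 / 2) ^ N *\<^sub>R G N"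
      by (subst add_eq_inf_sup) simp
    have "(\<Sum>k<Suc N. a k) \<le> (partial_sup a N + (\<Sum>k<N. (1 / 2) ^ k *\<^sub>R G k)) + a N"
      using Suc by simp
    also have "\<dots> = (partial_sup a N + a N) + (\<Sum>k<N. (1 / 2) ^ k *\<^sub>R G k)" by (simp add: ac_simps)
    also have "\<dots> \<le> (partial_sup a (Suc N) + (1 / 2) ^ N *\<^sub>R G N) + (\<Sum>k<N. (1 / 2) ^ k *\<^sub>R G k)"
      by (rule add_right_mono[OF step])
    also have "\<dots> = partial_sup a (Suc N) + (\<Sum>k<Suc N. (1 / 2) ^ k *\<^sub>R G k)" by (simp add: ac_simps)
    finally show ?case .
  qed simp
  also have "partial_sup a N \<le> u" using a u by (intro partial_sup_least)
  finally show ?thesis by (simp add: a_def)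
qed

text \<open>Evaluated at \<open>x\<close>, the preceding estimate bounds the partial sums of a
  series with nonnegative terms, so the terms tend to 0.\<close>

lemma almost_disjoint_uaw_null:
  fixes G :: "nat \<Rightarrow> 'a::banach_lattice dual"
  assumes G: "\<And>k. 0 \<le> G k" and bdd: "\<And>k. norm (G k) \<le> 1" and u: "0 \<le> u" and x: "0 \<le> x"
    and g: "\<And>k. g k = pprt (G k - 2 ^ k *\<^sub>R (\<Sum>i<k. G i))"
  shows "(\<lambda>k. inf (g k) u \<cdot> x) \<longlonglongrightarrow> 0"
proof (rule summable_LIMSEQ_zero, rule summableI_nonneg_bounded)
  show "0 \<le> inf (g k) u \<cdot> x" for k using u x by (intro dual_nonneg) (auto simp: g)
  fix N
  have "(\<Sum>k<N. inf (g k) u \<cdot> x) = (\<Sum>k<N. inf (g k) u) \<cdot> x" by (simp add: dual_apply_sum)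
  also have "\<dots> \<le> (u + (\<Sum>k<N. (1 / 2) ^ k *\<^sub>R G k)) \<cdot> x"
    by (rule dual_leD[OF almost_disjoint_sum_inf_le[OF G u g] x])
  also have "\<dots> = u \<cdot> x + (\<Sum>k<N. (1 / 2) ^ k * (G k \<cdot> x))" by (simp add: dual_apply_sum)
  also have "(\<Sum>k<N. (1 / 2) ^ k * (G k \<cdot> x)) \<le> (\<Sum>k<N. (1 / 2) ^ (0 + k) * norm x)"
  proof (rule sum_mono)
    fix k
    have "G k \<cdot> x \<le> norm (G k) * norm x" by (rule abs_le_D1[OF abs_dual_apply_le])
    also have "\<dots> \<le> 1 * norm x" by (intro mult_right_mono bdd) simp
    finally show "(1 / 2) ^ k * (G k \<cdot> x) \<le> (1 / 2) ^ (0 + k) * norm x" by simp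
  qed
  also have "\<dots> \<le> 2 * (1 / 2) ^ 0 * norm x"
    unfolding sum_distrib_right[symmetric] by (intro mult_right_mono sum_half_powers_le) simp
  finally show "(\<Sum>k<N. inf (g k) u \<cdot> x) \<le> u \<cdot> x + 2 * norm x" by simp
qed

lemma unbounded_grothendieck_imp_kb_space:
  assumes ug: "unbounded_grothendieck TYPE('a::banach_lattice)"
  shows "kb_space TYPE('a)"
  unfolding kb_space_def
proof (intro allI impI, rule ccontr)
  fix x :: "nat \<Rightarrow> 'a" assume inc: "incseq x" and bdd: "bounded (range x)" and "\<not> convergent x"
  then obtain e where e: "0 < e" and far: "\<And>N. \<exists>n\<ge>N. e \<le> norm (x n - x N)"
    by (auto simp: Cauchy_convergent_iff[symmetric] Cauchy_altdef2 dist_norm not_less)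
  have "\<exists>s. \<forall>k. True \<and> s k \<le> s (Suc k) \<and> e \<le> norm (x (s (Suc k)) - x (s k))"
    using far by (intro dependent_nat_choice) auto
  then obtain s where s: "\<And>k. s k \<le> s (Suc k)" "\<And>k. e \<le> norm (x (s (Suc k)) - x (s k))" by blast
  define y where "y k = x (s k)" for k
  have y: "incseq y" "bounded (range y)"
  proof -
    show "incseq y" unfolding incseq_Suc_iff y_def using inc s(1) by (auto intro: incseqD)
    show "bounded (range y)" using bdd by (rule bounded_subset) (auto simp: y_def)
  qed
  define d where "d k = y (Suc k) - y k" for k
  have d: "0 \<le> d k" for k using y(1) by (simp add: d_def incseq_Suc_iff)
  obtain \<phi> where \<phi>: "\<And>f. (\<lambda>n. f \<cdot> y n) \<longlonglongrightarrow> \<phi> \<cdot> f" using incseq_bounded_bidual_limit[OF y] by blast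
  \<comment> \<open>A single functional on E' dominates evaluation at every increment
    \<open>d k\<close>; it is the one that refutes weak convergence below.\<close>
  have f_d: "f \<cdot> d k \<le> (\<phi> - bidual (y 0)) \<cdot> f" if f: "0 \<le> f" for f k
  proof -
    have "f \<cdot> y (Suc k) \<le> \<phi> \<cdot> f"
      using y(1) by (intro LIMSEQ_le_const[OF \<phi>] exI[of _ "Suc k"]) (auto simp: incseq_def intro: dual_mono[OF f])
    moreover have "f \<cdot> y 0 \<le> f \<cdot> y k" using y(1) by (intro dual_mono[OF f]) (simp add: incseq_def)
    ultimately show ?thesis by (simp add: d_def)
  qed
  have d_null: "(\<lambda>k. f \<cdot> d k) \<longlonglongrightarrow> 0" for f
    using tendsto_diff[OF LIMSEQ_Suc[OF \<phi>] \<phi>, of f f] by (simp add: d_def)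
  have "\<exists>F. 0 \<le> F \<and> norm F \<le> 1 \<and> e \<le> F \<cdot> d k" for k
  proof -
    obtain F where "0 \<le> F" "norm F \<le> 1" "norm (pprt (d k)) \<le> F \<cdot> d k" by (rule exists_norming_functional)
    moreover have "e \<le> norm (pprt (d k))" using s(2)[of k] d[of k] by (simp add: d_def y_def)
    ultimately show ?thesis by (meson order_trans)
  qed
  then obtain F where F: "\<And>k. 0 \<le> F k" "\<And>k. norm (F k) \<le> 1" "\<And>k. e \<le> F k \<cdot> d k" by metis
  \<comment> \<open>The increments are weakly null, so the next one can be taken where 2^k times the
    sum of the earlier functionals is below e/2.\<close>
  let ?Q = "\<lambda>k A m. 2 ^ k * ((\<Sum>i\<in>A. F i) \<cdot> d m) < e / 2"
  have ex: "\<exists>m>N. ?Q k A m" for k N :: nat and A :: "nat set"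
  proof -
    have "(\<lambda>m. 2 ^ k * ((\<Sum>i\<in>A. F i) \<cdot> d m)) \<longlonglongrightarrow> 2 ^ k * 0" by (intro tendsto_mult_left d_null)
    from order_tendstoD(2)[OF this, of "e / 2"] e
    obtain M where "\<And>m. M \<le> m \<Longrightarrow> ?Q k A m" unfolding eventually_sequentially by auto
    then show ?thesis by (intro exI[of _ "max M (Suc N)"]) auto
  qed
  obtain r where r: "strict_mono r" "\<And>k. ?Q k (r ` {..<k}) (r k)"
    using select_subsequence[of ?Q, OF ex] by blast
  define G where "G k = F (r k)" for k
  have sum_G: "(\<Sum>i\<in>r ` {..<k}. F i) = (\<Sum>i<k. G i)" for k
    using strict_mono_imp_inj_on[OF r(1)] by (subst sum.reindex) (auto simp: G_def intro: inj_on_subset)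
  define g where "g k = pprt (G k - 2 ^ k *\<^sub>R (\<Sum>i<k. G i))" for k
  have G: "0 \<le> G k" "norm (G k) \<le> 1" for k by (simp_all add: G_def F)
  have g0: "0 \<le> g k" for k by (simp add: g_def)
  have "g k \<le> G k" for k
    unfolding g_def using G by (intro pprt_least) (auto simp: scaleR_nonneg_nonneg sum_nonneg)
  then have "norm (g k) \<le> 1" for k using norm_mono[OF g0] G(2) order_trans by blast
  then have "bounded (range g)" by (auto simp: bounded_iff)
  then have "(\<lambda>k. (\<phi> - bidual (y 0)) \<cdot> g k) \<longlonglongrightarrow> 0"
    by (rule unbounded_grothendieckD[OF ug _ g0]) (rule almost_disjoint_uaw_null[OF G _ _ g_def])
  \<comment> \<open>On \<open>d (r k)\<close> the functional \<open>G k\<close> is at least e and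
    the subtracted multiple is less than e/2. The positive part keeps at least e/2, and
    \<open>f_d\<close> transfers this to \<phi>.\<close>
  moreover have "e / 2 \<le> (\<phi> - bidual (y 0)) \<cdot> g k" for k
  proof -
    have "e / 2 \<le> (G k - 2 ^ k *\<^sub>R (\<Sum>i<k. G i)) \<cdot> d (r k)"
      using F(3)[of "r k"] r(2)[of k] by (simp add: sum_G) (simp add: G_def)
    also have "\<dots> \<le> g k \<cdot> d (r k)" unfolding g_def by (rule dual_leD[OF le_pprt d])
    also have "\<dots> \<le> (\<phi> - bidual (y 0)) \<cdot> g k" by (rule f_d[OF g0])
    finally show ?thesis .
  qed
  ultimately have "e / 2 \<le> 0" by (intro LIMSEQ_le_const) auto
  then show False using e by simp
qed

text \<open>Below a given \<open>f\<close> there is a largest element \<open>s\<close> on which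
  \<open>\<psi>\<close> vanishes. For each \<open>x\<close> disjointness splits \<open>f\<close>
  into a null element of \<open>\<psi>\<close> and a functional vanishing at \<open>x\<close>, so
  \<open>f\<close> and \<open>s\<close> compare at every \<open>x\<close> and f <= s
  follows.\<close>

lemma zero_if_disjoint_from_bidual:
  fixes \<psi> :: "'a::banach_lattice dual dual"
  assumes kb: "kb_space TYPE('a dual)" and \<psi>: "0 \<le> \<psi>" and disj: "\<And>x. 0 \<le> x \<Longrightarrow> inf \<psi> (bidual x) = 0"
  shows "\<psi> = 0"
proof -
  have "\<psi> \<cdot> f \<le> 0" if f: "0 \<le> f" for f
  proof -
    define D where "D = {g\<in>{0..f}. \<psi> \<cdot> g = 0}"
    have sup_D: "\<forall>g\<in>D. \<forall>h\<in>D. sup g h \<in> D"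
    proof (intro ballI)
      fix g h assume that: "g \<in> D" "h \<in> D"
      have gh: "0 \<le> g" "0 \<le> h" "g \<le> f" "h \<le> f" "\<psi> \<cdot> g = 0" "\<psi> \<cdot> h = 0" using that by (auto simp: D_def)
      have "\<psi> \<cdot> sup g h \<le> \<psi> \<cdot> (g + h)" using gh by (intro dual_mono[OF \<psi>] sup_least) simp_all
      moreover have "0 \<le> \<psi> \<cdot> sup g h" using gh by (intro dual_nonneg[OF \<psi>] le_supI1)
      ultimately show "sup g h \<in> D" using gh by (simp add: D_def le_supI1)
    qed
    have "0 \<in> D" using f by (simp add: D_def)
    then have "D \<noteq> {}" by blast
    have bdd: "bounded D" by (rule bounded_subset[OF bounded_order_interval[of f]]) (auto simp: D_def)
    obtain s X where X: "\<forall>n. X n \<in> D" "X \<longlonglongrightarrow> s" and upper: "\<forall>d\<in>D. d \<le> s"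
      by (rule kb_space_directed_sup[OF kb \<open>D \<noteq> {}\<close> bdd sup_D]) (rule that)
    have "(\<lambda>n. \<psi> \<cdot> X n) \<longlonglongrightarrow> \<psi> \<cdot> s" by (rule tendsto_dual_apply[OF X(2)])
    moreover have "\<psi> \<cdot> X n = 0" for n using X(1)[rule_format, of n] by (simp add: D_def)
    ultimately have "\<psi> \<cdot> s = 0" by (simp add: LIMSEQ_const_iff)
    have "f \<le> s"
    proof (rule dual_leI)
      fix x :: 'a assume x: "0 \<le> x"
      obtain z where z: "z \<in> {0..f}" "\<psi> \<cdot> z = 0" "bidual x \<cdot> (f - z) = 0"
        using kb_space_disjoint_functionals[OF kb \<psi> bidual_nonneg[OF x] disj[OF x] f] by blast
      then have "z \<le> s" by (intro upper[rule_format]) (simp add: D_def)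
      then show "f \<cdot> x \<le> s \<cdot> x" using z(3) dual_leD[OF _ x, of z s] by simp
    qed
    then show ?thesis using dual_mono[OF \<psi>, of f s] \<open>\<psi> \<cdot> s = 0\<close> by simp
  qed
  then have "\<psi> \<le> 0" by (simp add: dual_le_iff)
  then show ?thesis using \<psi> by simp
qed

text \<open>The functional \<open>f\<close> lives where
  \<open>\<theta> \<ge> \<gamma> x\<close>, and \<open>x - s\<close> is the component of \<open>x\<close> in the carrier of \<open>f\<close>.\<close>

lemma bidual_below:
  fixes \<theta> :: "'a::banach_lattice dual dual"
  assumes kb: "kb_space TYPE('a)" and kb': "kb_space TYPE('a dual)"
    and \<theta>: "0 \<le> \<theta>" "\<theta> \<noteq> 0" "\<theta> \<le> bidual x" and x: "0 \<le> x"
  obtains y where "0 \<le> y" "y \<noteq> 0" "bidual y \<le> \<theta>"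
proof -
  have "\<not> \<theta> \<le> 0" using \<theta> by auto
  then obtain f0 where f0: "0 \<le> f0" "0 < \<theta> \<cdot> f0" by (auto simp: dual_le_iff not_le)
  have f0x: "\<theta> \<cdot> f0 \<le> f0 \<cdot> x" using dual_leD[OF \<theta>(3) f0(1)] by simp
  \<comment> \<open>Half the ratio of the values of \<open>\<theta>\<close> and
    \<open>bidual x\<close> at \<open>f0\<close>, so that \<open>\<kappa>\<close> is still strictly
    positive at \<open>f0\<close>.\<close>
  define \<gamma> where "\<gamma> = \<theta> \<cdot> f0 / (2 * (f0 \<cdot> x))"
  have \<gamma>: "0 < \<gamma>" using f0 f0x by (simp add: \<gamma>_def)
  define \<kappa> where "\<kappa> = \<theta> - \<gamma> *\<^sub>R bidual x"
  have "\<kappa> \<cdot> f0 = \<theta> \<cdot> f0 / 2" using f0 f0x by (simp add: \<kappa>_def \<gamma>_def)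
  then have pos: "0 < pprt \<kappa> \<cdot> f0" using f0 dual_leD[OF le_pprt f0(1), of \<kappa>] by simp
  \<comment> \<open>Splitting \<open>f0\<close> along the disjoint parts of \<open>\<kappa>\<close>
    leaves a remainder on which the negative part of \<open>\<kappa>\<close> vanishes and the
    positive part keeps its whole value.\<close>
  obtain z0 where z0: "z0 \<in> {0..f0}" "pprt \<kappa> \<cdot> z0 = 0" "pprt (- \<kappa>) \<cdot> (f0 - z0) = 0"
    using kb_space_disjoint_functionals[OF kb' zero_le_pprt zero_le_pprt inf_pprt_pprt_uminus f0(1), of \<kappa>] by blast
  define f where "f = f0 - z0"
  have f: "0 \<le> f" using z0(1) by (simp add: f_def)
  have \<theta>_ge: "\<gamma> * (g \<cdot> x) \<le> \<theta> \<cdot> g" if g: "0 \<le> g" "g \<le> f" for g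
  proof -
    have "pprt (- \<kappa>) \<cdot> g \<le> pprt (- \<kappa>) \<cdot> f" using g by (intro dual_mono zero_le_pprt)
    then have "pprt (- \<kappa>) \<cdot> g \<le> 0" using z0(3) by (simp only: f_def)
    moreover have "(- \<kappa>) \<cdot> g \<le> pprt (- \<kappa>) \<cdot> g" by (rule dual_leD[OF le_pprt g(1)])
    ultimately have "0 \<le> \<kappa> \<cdot> g" by simp
    then show ?thesis by (simp add: \<kappa>_def)
  qed
  have fx: "0 < f \<cdot> x"
  proof -
    have "pprt (- \<kappa>) \<cdot> f = 0" "pprt \<kappa> \<cdot> f = pprt \<kappa> \<cdot> f0" using z0(2,3) by (simp_all add: f_def)
    then have "(pprt \<kappa> - pprt (- \<kappa>)) \<cdot> f > 0" using pos by simp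
    then have "0 < \<kappa> \<cdot> f" by (simp only: pprt_diff_pprt)
    moreover have "0 \<le> \<gamma> * (f \<cdot> x)" using \<gamma> f x by (simp add: dual_nonneg)
    moreover have "\<theta> \<cdot> f \<le> f \<cdot> x" using dual_leD[OF \<theta>(3) f] by simp
    ultimately show ?thesis by (simp add: \<kappa>_def)
  qed
  \<comment> \<open>The largest element \<open>s\<close> of this set is the component of
    \<open>x\<close> on which \<open>f\<close> vanishes.\<close>
  define D where "D = {z\<in>{0..x}. f \<cdot> z = 0}"
  have sup_D: "\<forall>a\<in>D. \<forall>b\<in>D. sup a b \<in> D"
  proof (intro ballI)
    fix a b assume that: "a \<in> D" "b \<in> D"
    have ab: "0 \<le> a" "0 \<le> b" "a \<le> x" "b \<le> x" "f \<cdot> a = 0" "f \<cdot> b = 0" using that by (auto simp: D_def)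
    have "f \<cdot> sup a b \<le> f \<cdot> (a + b)" using ab by (intro dual_mono[OF f] sup_least) simp_all
    moreover have "0 \<le> f \<cdot> sup a b" using ab by (intro dual_nonneg[OF f] le_supI1)
    ultimately show "sup a b \<in> D" using ab by (simp add: D_def le_supI1)
  qed
  have "0 \<in> D" using x by (simp add: D_def)
  then have "D \<noteq> {}" by blast
  have bdd: "bounded D" by (rule bounded_subset[OF bounded_order_interval[of x]]) (auto simp: D_def)
  obtain s X where X: "\<forall>n. X n \<in> D" "X \<longlonglongrightarrow> s" and upper: "\<forall>d\<in>D. d \<le> s"
    by (rule kb_space_directed_sup[OF kb \<open>D \<noteq> {}\<close> bdd sup_D]) (rule that)
  have "(\<lambda>n. f \<cdot> X n) \<longlonglongrightarrow> f \<cdot> s" by (rule tendsto_dual_apply[OF X(2)])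
  moreover have XD: "f \<cdot> X n = 0" "X n \<le> x" for n using X(1)[rule_format, of n] by (simp_all add: D_def)
  ultimately have fs: "f \<cdot> s = 0" by (simp add: LIMSEQ_const_iff)
  have sx: "s \<le> x" by (rule lattice_lim_le[OF X(2) XD(2)])
  have s0: "0 \<le> s" using upper \<open>0 \<in> D\<close> by blast
  \<comment> \<open>Functionals disjoint from \<open>f\<close> do not see the carrier of
    \<open>f\<close>: splitting \<open>x\<close> for \<open>f\<close> and \<open>h\<close> gives an
    element below \<open>s\<close> off which \<open>h\<close> vanishes.\<close>
  have carrier: "h \<cdot> (x - s) = 0" if h: "0 \<le> h" "inf f h = 0" for h
  proof -
    obtain z where z: "z \<in> {0..x}" "f \<cdot> z = 0" "h \<cdot> (x - z) = 0"
      using kb_space_disjoint_functionals[OF kb f h x] by blast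
    then have "z \<le> s" by (intro upper[rule_format]) (simp add: D_def)
    then have "h \<cdot> (x - s) \<le> h \<cdot> (x - z)" by (intro dual_mono[OF h(1)] diff_left_mono)
    moreover have "0 \<le> h \<cdot> (x - s)" using sx by (intro dual_nonneg[OF h(1)]) simp
    ultimately show ?thesis using z(3) by linarith
  qed
  show ?thesis
  proof
    show "0 \<le> \<gamma> *\<^sub>R (x - s)" using sx \<gamma> by (intro scaleR_nonneg_nonneg) simp_all
    show "\<gamma> *\<^sub>R (x - s) \<noteq> 0" using \<gamma> fs fx by auto
    show "bidual (\<gamma> *\<^sub>R (x - s)) \<le> \<theta>"
    proof (rule dual_leI)
      fix h :: "'a dual" assume h: "0 \<le> h"
      \<comment> \<open>\<open>h\<close> is split into \<open>g n\<close>, which lies below a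
        multiple of \<open>f\<close>, and a remainder that decreases to a functional disjoint from
        \<open>f\<close>. On the first part \<open>\<theta>\<close> dominates, and the second tends
        to 0 at \<open>x - s\<close>.\<close>
      define R where "R n = pprt (h - real (Suc n) *\<^sub>R f)" for n
      define g where "g n = inf h (real (Suc n) *\<^sub>R f)" for n
      have h_eq: "h = g n + R n" for n unfolding g_def R_def inf_eq_pprt by simp
      have R0: "0 \<le> R n" for n by (simp add: R_def)
      have "decseq R"
        unfolding R_def using f by (auto simp: decseq_def intro!: pprt_mono diff_left_mono scaleR_right_mono)
      then have "convergent R" by (rule kb_space_decseq_convergent[OF kb' _ R0])
      then obtain \<rho> where \<rho>: "R \<longlonglongrightarrow> \<rho>" by (auto simp: convergent_def)
      have \<rho>0: "0 \<le> \<rho>" by (rule lattice_le_lim[OF \<rho> R0])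
      have "inf f \<rho> \<le> 0 *\<^sub>R h"
      proof (rule lattice_tendsto_le)
        show "(\<lambda>n. inf f (R n)) \<longlonglongrightarrow> inf f \<rho>" by (intro tendsto_inf tendsto_const \<rho>)
        show "(\<lambda>n. inverse (real (Suc n)) *\<^sub>R h) \<longlonglongrightarrow> 0 *\<^sub>R h"
          by (intro tendsto_scaleR LIMSEQ_inverse_real_of_nat tendsto_const)
        show "inf f (R n) \<le> inverse (real (Suc n)) *\<^sub>R h" for n
          using inf_pprt_diff_scaleR_le[OF h f, of "real (Suc n)"]
          by (simp add: R_def inf_commute inverse_eq_divide)
      qed
      then have "inf f \<rho> = 0" using f \<rho>0 by (intro antisym) simp_all
      then have \<rho>s: "\<rho> \<cdot> (x - s) = 0" by (rule carrier[OF \<rho>0])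
      have "\<gamma> * (h \<cdot> (x - s)) \<le> \<theta> \<cdot> h + \<gamma> * (R n \<cdot> (x - s))" for n
      proof -
        have g0: "0 \<le> g n" using h f by (simp add: g_def scaleR_nonneg_nonneg)
        \<comment> \<open>Rescaling brings \<open>g n\<close> below \<open>f\<close>, where
          \<open>\<theta>_ge\<close> applies.\<close>
        have "(1 / real (Suc n)) *\<^sub>R g n \<le> (1 / real (Suc n)) *\<^sub>R real (Suc n) *\<^sub>R f"
          by (intro scaleR_left_mono) (simp_all add: g_def)
        then have "\<gamma> * (((1 / real (Suc n)) *\<^sub>R g n) \<cdot> x) \<le> \<theta> \<cdot> ((1 / real (Suc n)) *\<^sub>R g n)"
          using g0 by (intro \<theta>_ge scaleR_nonneg_nonneg) simp_all
        then have "1 / real (Suc n) * (\<gamma> * (g n \<cdot> x)) \<le> 1 / real (Suc n) * (\<theta> \<cdot> g n)"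
          by (simp only: dual_apply_simps mult.left_commute[of \<gamma>])
        then have "\<gamma> * (g n \<cdot> x) \<le> \<theta> \<cdot> g n" by (rule mult_left_le_imp_le) simp
        moreover have "\<theta> \<cdot> g n \<le> \<theta> \<cdot> h" by (intro dual_mono \<theta>) (simp add: g_def)
        moreover have "g n \<cdot> (x - s) \<le> g n \<cdot> x" using s0 by (intro dual_mono g0) simp
        moreover have "\<gamma> * (g n \<cdot> (x - s)) \<le> \<gamma> * (g n \<cdot> x)"
          using calculation(3) \<gamma> by (intro mult_left_mono) simp_all
        moreover have "h \<cdot> (x - s) = g n \<cdot> (x - s) + R n \<cdot> (x - s)"
          by (subst h_eq[of n]) (simp only: dual_apply_simps)
        ultimately show ?thesis by (simp only: distrib_left)
      qed
      then have "\<gamma> * (h \<cdot> (x - s)) \<le> \<theta> \<cdot> h + \<gamma> * (\<rho> \<cdot> (x - s))"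
        by (intro LIMSEQ_le_const[OF tendsto_add[OF tendsto_const tendsto_mult_left[OF tendsto_dual_apply_left[OF \<rho>]]]]) blast
      then show "bidual (\<gamma> *\<^sub>R (x - s)) \<cdot> h \<le> \<theta> \<cdot> h" unfolding \<rho>s by simp
    qed
  qed
qed

lemma kb_space_imp_reflexive:
  assumes kb: "kb_space TYPE('a::banach_lattice)" and kb': "kb_space TYPE('a dual)"
  shows "reflexive_space TYPE('a)"
  unfolding reflexive_space_iff
proof
  have pos: "\<exists>x. \<phi> = bidual x" if \<phi>: "0 \<le> \<phi>" for \<phi> :: "'a dual dual"
  proof -
    define S where "S = {x. 0 \<le> x \<and> bidual x \<le> \<phi>}"
    have sup_S: "\<forall>x\<in>S. \<forall>y\<in>S. sup x y \<in> S"
    proof (intro ballI)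
      fix x y assume that: "x \<in> S" "y \<in> S"
      have xy: "0 \<le> x" "\<And>f. 0 \<le> f \<Longrightarrow> f \<cdot> x \<le> \<phi> \<cdot> f" "\<And>f. 0 \<le> f \<Longrightarrow> f \<cdot> y \<le> \<phi> \<cdot> f"
        using that by (auto simp: S_def dual_le_iff)
      have "f \<cdot> sup x y \<le> \<phi> \<cdot> f" if "0 \<le> f" for f
      proof -
        \<comment> \<open>The value of \<open>f\<close> at \<open>sup x y\<close> is split into a
          part g evaluated at \<open>x\<close> and the rest evaluated at \<open>y\<close>; each is
          bounded by \<phi>.\<close>
        from exists_dual_apply_eq_pprt[OF that, of "x - y"]
        obtain g where g: "0 \<le> g" "g \<le> f" "g \<cdot> (x - y) = f \<cdot> pprt (x - y)" by blast
        have "f \<cdot> sup x y = g \<cdot> x + (f - g) \<cdot> y" using g(3) by (simp add: sup_eq_pprt)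
        also have "\<dots> \<le> \<phi> \<cdot> g + \<phi> \<cdot> (f - g)" using g by (intro add_mono xy) simp_all
        finally show ?thesis by simp
      qed
      then show "sup x y \<in> S" using xy(1) by (simp add: S_def dual_le_iff le_supI1)
    qed
    have "0 \<in> S" using \<phi> by (simp add: S_def dual_le_iff dual_nonneg)
    then have "S \<noteq> {}" by blast
    have "norm x \<le> norm \<phi>" if "x \<in> S" for x
    proof -
      obtain F where F: "0 \<le> F" "norm F \<le> 1" "norm (pprt x) \<le> F \<cdot> x" by (rule exists_norming_functional)
      have "norm x \<le> F \<cdot> x" using F that by (simp add: S_def)
      also have "\<dots> \<le> \<phi> \<cdot> F" using that F by (auto simp: S_def dual_le_iff)
      also have "\<dots> \<le> norm \<phi> * norm F" by (rule abs_le_D1[OF abs_dual_apply_le])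
      also have "\<dots> \<le> norm \<phi> * 1" by (intro mult_left_mono F) simp
      finally show ?thesis by simp
    qed
    then have bdd: "bounded S" by (auto simp: bounded_iff)
    obtain s X where X: "\<forall>n. X n \<in> S" "X \<longlonglongrightarrow> s" and upper: "\<forall>d\<in>S. d \<le> s"
      by (rule kb_space_directed_sup[OF kb \<open>S \<noteq> {}\<close> bdd sup_S]) (rule that)
    have le: "bidual s \<le> \<phi>"
    proof (rule dual_leI)
      fix f :: "'a dual" assume "0 \<le> f"
      then have "f \<cdot> X n \<le> \<phi> \<cdot> f" for n using X(1)[rule_format, of n] by (auto simp: S_def dual_le_iff)
      then show "bidual s \<cdot> f \<le> \<phi> \<cdot> f" using LIMSEQ_le_const2[OF tendsto_dual_apply[OF X(2)], of f] by simp
    qed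
    have s0: "0 \<le> s" using upper \<open>0 \<in> S\<close> by blast
    have "\<phi> - bidual s = 0"
    \<comment> \<open>If the difference were not disjoint from some \<open>bidual x\<close>, then
      \<open>bidual_below\<close> would give a positive y that can be added to \<open>s\<close>
      inside \<open>S\<close>, contradicting maximality of \<open>s\<close>.\<close>
    proof (rule zero_if_disjoint_from_bidual[OF kb'], simp add: le, rule ccontr)
      fix x :: 'a assume x: "0 \<le> x" and ne: "inf (\<phi> - bidual s) (bidual x) \<noteq> 0"
      have "0 \<le> inf (\<phi> - bidual s) (bidual x)" using le bidual_nonneg[OF x] by simp
      then obtain y where y: "0 \<le> y" "y \<noteq> 0" "bidual y \<le> inf (\<phi> - bidual s) (bidual x)"
        using bidual_below[OF kb kb' _ ne inf_le2 x] by blast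
      have "bidual (s + y) = bidual s + bidual y" by (rule dual_eqI) simp
      also have "\<dots> \<le> \<phi>" using y(3) by (simp add: le_diff_eq add.commute)
      finally have "s + y \<in> S" using s0 y(1) by (simp add: S_def)
      from upper[rule_format, OF this] y(1,2) show False by simp
    qed
    then show ?thesis by (intro exI[of _ s]) simp
  qed
  fix \<phi> :: "'a dual dual"
  obtain a b where "pprt \<phi> = bidual a" "pprt (- \<phi>) = bidual b" using pos zero_le_pprt by metis
  then have "\<phi> = bidual a - bidual b" using pprt_diff_pprt[of \<phi>] by simp
  also have "\<dots> = bidual (a - b)" by (rule dual_eqI) simp
  finally show "\<exists>x. \<phi> = bidual x" by blast
qed

theorem theorem2p4:
  shows "reflexive_space TYPE('a::banach_lattice) \<longleftrightarrow> unbounded_grothendieck TYPE('a)"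
  using reflexive_imp_unbounded_grothendieck unbounded_grothendieck_imp_kb_space
    unbounded_grothendieck_imp_kb_space_dual kb_space_imp_reflexive by blast

end
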